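(* Let $G$ be a connected graph of size $m$ (i.e. with $m$ edges) such that $G$ is not isomorphic to $C_4$. Then $$\iota(G,C_4) \leq \frac{m+1}{6}.$$ Moreover, equality holds if and only if $G \in \{K_4^-\} \cup \mathcal{G}_4$.
   Context: All graphs are finite and simple. $C_k$ denotes the cycle of length $k$. For a graph $G$ and $D\subseteq V(G)$, $N[D]$ is the closed neighbourhood of $D$ (the vertices of $D$ together with all their neighbours), and $G-N[D]$ is the subgraph induced by $V(G)\setminus N[D]$. A set $D\subseteq V(G)$ is a $C_k$-isolating set of $G$ if $G-N[D]$ contains no subgraph isomorphic to $C_k$; the $C_k$-isolation number $\iota(G,C_k)$ is the minimum cardinality of a $C_k$-isolating set of $G$. $K_4^-$ is the diamond graph, obtained from $K_4$ by deleting one edge. For a tree $T$, ${\rm cons}(T,C_k)$ is the graph obtained from $T$ and $|V(T)|$ pairwise vertex-disjoint copies of $C_k$ (also disjoint from $T$), one for each vertex of $T$, by joining each vertex of $T$ by a single edge to one vertex of its own copy of $C_k$. $\mathcal{G}_k=\{{\rm cons}(T,C_k): T \text{ is a tree}\}$ (for $k\ge 3$). *)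

theory Defs
  imports Complex_Main
begin

record 'a ugraph =
  verts :: "'a set"
  edges :: "'a set set"

definition simple_graph :: "'a ugraph \<Rightarrow> bool" where
  "simple_graph G \<longleftrightarrow> finite (verts G) \<and> (\<forall>e\<in>edges G. e \<subseteq> verts G \<and> card e = 2)"

definition isomorphic :: "'a ugraph \<Rightarrow> 'b ugraph \<Rightarrow> bool" where
  "isomorphic G H \<longleftrightarrow> (\<exists>f. bij_betw f (verts G) (verts H) \<and>
     (\<forall>u\<in>verts G. \<forall>v\<in>verts G. {u, v} \<in> edges G \<longleftrightarrow> {f u, f v} \<in> edges H))"

text \<open>Not necessarily induced; \<open>simple_graph S\<close> keeps the ends of the edges of \<open>S\<close> inside \<open>S\<close>.\<close>

definition subgraph :: "'a ugraph \<Rightarrow> 'a ugraph \<Rightarrow> bool" where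
  "subgraph S G \<longleftrightarrow> simple_graph S \<and> verts S \<subseteq> verts G \<and> edges S \<subseteq> edges G"

definition contains_copy :: "'a ugraph \<Rightarrow> 'b ugraph \<Rightarrow> bool" where
  "contains_copy G H \<longleftrightarrow> (\<exists>S. subgraph S G \<and> isomorphic S H)"

definition induced :: "'a ugraph \<Rightarrow> 'a set \<Rightarrow> 'a ugraph" where
  "induced G W = \<lparr>verts = verts G \<inter> W, edges = {e \<in> edges G. e \<subseteq> W}\<rparr>"

text \<open>The null graph is not regarded as connected; in particular a tree has at least one vertex.\<close>

definition connected_graph :: "'a ugraph \<Rightarrow> bool" where
  "connected_graph G \<longleftrightarrow> verts G \<noteq> {} \<and>
     (\<forall>u\<in>verts G. \<forall>v\<in>verts G. (u, v) \<in> {(x, y). {x, y} \<in> edges G}\<^sup>*)"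

text \<open>The cycle \<open>C\<^sub>k\<close>; meaningful for \<open>k \<ge> 3\<close>.\<close>

definition cycle_graph :: "nat \<Rightarrow> nat ugraph" where
  "cycle_graph k = \<lparr>verts = {..<k}, edges = {{i, Suc i mod k} | i. i < k}\<rparr>"

definition complete_graph :: "nat \<Rightarrow> nat ugraph" where
  "complete_graph n = \<lparr>verts = {..<n}, edges = {{i, j} | i j. i < n \<and> j < n \<and> i \<noteq> j}\<rparr>"

definition diamond :: "nat ugraph" where
  "diamond = \<lparr>verts = verts (complete_graph 4), edges = edges (complete_graph 4) - {{0, 1}}\<rparr>"

definition tree :: "'a ugraph \<Rightarrow> bool" where
  "tree T \<longleftrightarrow> simple_graph T \<and> connected_graph T \<and> (\<forall>k\<ge>3. \<not> contains_copy T (cycle_graph k))"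

definition closed_nbhd :: "'a ugraph \<Rightarrow> 'a set \<Rightarrow> 'a set" where
  "closed_nbhd G D = D \<union> {v \<in> verts G. \<exists>u\<in>D. {u, v} \<in> edges G}"

definition isolating_set :: "'a ugraph \<Rightarrow> 'b ugraph \<Rightarrow> 'a set \<Rightarrow> bool" where
  "isolating_set G H D \<longleftrightarrow>
     D \<subseteq> verts G \<and> \<not> contains_copy (induced G (verts G - closed_nbhd G D)) H"

definition isolation_number :: "'a ugraph \<Rightarrow> 'b ugraph \<Rightarrow> nat" where
  "isolation_number G H = (LEAST n. \<exists>D. isolating_set G H D \<and> card D = n)"

text \<open>
  The graph \<open>cons(T, C\<^sub>k)\<close>: \<open>Inl v\<close> is the vertex \<open>v\<close> of \<open>T\<close> and \<open>Inr (v, i)\<close> is the vertex \<open>i\<close> of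
  the copy of \<open>C\<^sub>k\<close> belonging to \<open>v\<close>. Since cycles are vertex-transitive, the choice of the
  vertex \<open>0\<close> as the attachment vertex in every copy is no restriction up to isomorphism.
\<close>

definition cons_graph :: "'a ugraph \<Rightarrow> nat \<Rightarrow> ('a + 'a \<times> nat) ugraph" where
  "cons_graph T k =
    \<lparr>verts = Inl ` verts T \<union> Inr ` (verts T \<times> verts (cycle_graph k)),
     edges = {{Inl u, Inl v} | u v. {u, v} \<in> edges T}
       \<union> {{Inr (v, i), Inr (v, j)} | v i j. v \<in> verts T \<and> {i, j} \<in> edges (cycle_graph k)}
       \<union> {{Inl v, Inr (v, 0)} | v. v \<in> verts T}\<rparr>"

text \<open>
  The family \<open>\<G>\<^sub>k\<close>, closed under isomorphism. Every finite tree is isomorphic to one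
  whose vertices are natural numbers, so quantifying over these covers all trees.
\<close>

definition cons_family :: "nat \<Rightarrow> 'a ugraph set" where
  "cons_family k = {G. \<exists>T :: nat ugraph. tree T \<and> isomorphic G (cons_graph T k)}"

end

theory Submission
  imports Defs
begin

text \<open>
  Remove from a connected graph a set \<open>R\<close> dominated by one vertex \<open>x\<close>, or nearly so: the vertices
  of \<open>R\<close> outside \<open>N[x]\<close> must lie on no four-cycle avoiding \<open>N[x]\<close>. This costs one vertex of the
  isolating set and yields the edges inside \<open>R\<close>; by induction every component \<open>H\<close> of the rest
  pays for itself out of its own edges and the edges joining it to \<open>R\<close>. The deficit of \<open>H\<close> is two edges
  if \<open>H\<close> is a four-cycle, one if \<open>H\<close> is extremal (a diamond or a member of \<open>\<G>\<^sub>4\<close>) and zero otherwise,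
  so six edges have to be gained in total.

  If some vertex \<open>x\<close> leaves a four-cycle as a component, take \<open>R\<close> to be this four-cycle together with
  \<open>x\<close>; equality forces all other components to be members of \<open>\<G>\<^sub>4\<close> attached to \<open>x\<close> by one edge at
  their trees. If some vertex leaves an extremal component, that vertex already
  saves one vertex of the component. Otherwise every four-cycle or extremal component is attached to at least two
  vertices of \<open>R\<close>, so that only four-cycles with exactly two connecting edges contribute no gain, and a
  suitable \<open>R\<close> is found around a vertex whose closed neighbourhood spans at least five edges or,
  failing that, around a four-cycle, according to the degrees of its vertices.
\<close>

subsection \<open>Edge counts and components\<close>

text \<open>The constant six is the price in edges of one chosen vertex. The induction has to carry
  the shape of the exceptions and not only the bound, because what makes an exceptional component
  cheap is where it is touched: a copy met by the closed neighbourhood of the centre saves a whole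
  vertex. What is carried is one-sided, however; that diamonds and members of the family attain the
  bound is counted directly at the end.

  The obstacle is a four-cycle component \<open>H\<close> with exactly two connecting edges, as its
  deficit swallows both. The way round it is an exchange. Such an \<open>H\<close> has four edges of
  its own, so it is worth removing in its turn, around an end of one of its connecting edges. A
  vertex of \<open>H\<close> is then dominated, so no four-cycle survives inside \<open>H\<close>;
  and one that enters from outside would cross twice, although just one connecting edge is left.

  Subgraphs are vertex sets over one fixed edge set, so components of components need no transport;
  graphs proper, trees and isomorphisms appear only in the translation of the result.\<close>

locale edge_system =
  fixes E :: "'a set set"
  assumes card_edge: "e \<in> E \<Longrightarrow> card e = 2"
begin

definition adj :: "'a \<Rightarrow> 'a \<Rightarrow> bool" where
  "adj u v \<longleftrightarrow> {u, v} \<in> E"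

lemma adj_sym: "adj u v \<longleftrightarrow> adj v u"
  by (simp add: adj_def insert_commute)

lemma not_adj_self [simp]: "\<not> adj u u"
  using card_edge[of "{u}"] by (auto simp: adj_def)

lemma edge_cases:
  assumes "e \<in> E"
  obtains u v where "e = {u, v}" "u \<noteq> v" "adj u v"
  using card_edge[OF assms] assms by (auto simp: card_2_iff adj_def)

text \<open>Graphs are represented by vertex sets: \<open>inner W\<close> is the edge set of the subgraph induced by \<open>W\<close>.\<close>

definition inner :: "'a set \<Rightarrow> 'a set set" where
  "inner W = {e \<in> E. e \<subseteq> W}"

definition between :: "'a set \<Rightarrow> 'a set \<Rightarrow> 'a set set" where
  "between H R = {e \<in> E. e \<subseteq> H \<union> R \<and> e \<inter> H \<noteq> {} \<and> e \<inter> R \<noteq> {}}"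

lemma finite_inner: "finite W \<Longrightarrow> finite (inner W)"
  by (rule finite_subset[of _ "Pow W"]) (auto simp: inner_def)

lemma finite_between: "finite H \<Longrightarrow> finite R \<Longrightarrow> finite (between H R)"
  by (rule finite_subset[of _ "Pow (H \<union> R)"]) (auto simp: between_def)

lemma inner_mono: "U \<subseteq> W \<Longrightarrow> inner U \<subseteq> inner W"
  by (auto simp: inner_def)

lemma edge_in_between: "adj u v \<Longrightarrow> u \<in> H \<Longrightarrow> v \<in> R \<Longrightarrow> {u, v} \<in> between H R"
  by (auto simp: adj_def between_def)

text \<open>Edges are nonempty and the \<open>A i\<close> are disjoint, so an edge inside
  \<open>A i\<close> or joining \<open>A i\<close> to \<open>R\<close> determines \<open>i\<close>
  and no edge is counted twice. Lost are only edges between different \<open>A i\<close> and edges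
  at the remaining vertices; for the components of \<open>W - R\<close> there are none of
  these.\<close>

lemma card_inner_family:
  assumes "finite W" "finite I" "R \<subseteq> W" "\<And>i. i \<in> I \<Longrightarrow> A i \<subseteq> W - R"
    and disj: "\<And>i j. i \<in> I \<Longrightarrow> j \<in> I \<Longrightarrow> i \<noteq> j \<Longrightarrow> A i \<inter> A j = {}"
  shows "card (inner R) + (\<Sum>i\<in>I. card (inner (A i)) + card (between (A i) R)) \<le> card (inner W)"
proof -
  have fin: "finite R" "\<And>i. i \<in> I \<Longrightarrow> finite (A i)"
    using assms finite_subset by (blast, meson Diff_subset finite_subset)
  let ?B = "\<lambda>i. inner (A i) \<union> between (A i) R"
  have ne: "e \<noteq> {}" if "e \<in> E" for e using card_edge[OF that] by auto
  have c: "card (?B i) = card (inner (A i)) + card (between (A i) R)" if "i \<in> I" for i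
  proof (rule card_Un_disjoint)
    show "inner (A i) \<inter> between (A i) R = {}"
      using assms(4)[OF that] by (auto simp: inner_def between_def)
  qed (use fin that in \<open>auto simp: finite_inner finite_between\<close>)
  have d: "?B i \<inter> ?B j = {}" if "i \<in> I" "j \<in> I" "i \<noteq> j" for i j
  proof -
    have e: "e \<inter> A i \<noteq> {}" "e \<subseteq> A i \<union> R" if "e \<in> ?B i" for e i
      using that ne by (auto simp: inner_def between_def)
    have False if "e \<in> ?B i" "e \<in> ?B j" for e
      using e[OF that(1)] e[OF that(2)] disj[OF \<open>i \<in> I\<close> \<open>j \<in> I\<close> \<open>i \<noteq> j\<close>] assms(4)[OF \<open>i \<in> I\<close>] by blast
    then show ?thesis by blast
  qed
  have "card (\<Union>i\<in>I. ?B i) = (\<Sum>i\<in>I. card (?B i))"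
    using d fin assms(2) by (intro card_UN_disjoint) (auto simp: finite_inner finite_between)
  moreover have "card (inner R \<union> (\<Union>i\<in>I. ?B i)) = card (inner R) + card (\<Union>i\<in>I. ?B i)"
  proof (rule card_Un_disjoint)
    show "inner R \<inter> (\<Union>i\<in>I. ?B i) = {}"
      using ne assms(4) by (fastforce simp: inner_def between_def)
  qed (use fin assms(2) in \<open>auto simp: finite_inner finite_between\<close>)
  moreover have "card (inner R \<union> (\<Union>i\<in>I. ?B i)) \<le> card (inner W)"
  proof (rule card_mono)
    show "inner R \<union> (\<Union>i\<in>I. ?B i) \<subseteq> inner W"
      using assms(3,4) by (fastforce simp: inner_def between_def)
  qed (use assms finite_inner in auto)
  ultimately show ?thesis using c by simp
qed

text \<open>Connectivity by cuts, which avoids walks.\<close>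

definition conn :: "'a set \<Rightarrow> bool" where
  "conn C \<longleftrightarrow> C \<noteq> {} \<and> (\<forall>S. S \<subseteq> C \<and> S \<noteq> {} \<and> S \<noteq> C \<longrightarrow> (\<exists>u\<in>S. \<exists>v\<in>C - S. adj u v))"

lemma conn_cut:
  assumes "conn C" "x \<in> C" "x \<in> S" "y \<in> C" "y \<notin> S"
  obtains u v where "u \<in> C" "u \<in> S" "v \<in> C" "v \<notin> S" "adj u v"
proof -
  have "C \<inter> S \<subseteq> C \<and> C \<inter> S \<noteq> {} \<and> C \<inter> S \<noteq> C" using assms by auto
  then have "\<exists>u\<in>C \<inter> S. \<exists>v\<in>C - (C \<inter> S). adj u v" using assms(1) unfolding conn_def by blast
  then show thesis using that by blast
qed

text \<open>Cuts are symmetric: a set missing the root is handled through its complement.\<close>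

lemma connI:
  assumes "r \<in> C"
    and "\<And>S. r \<in> S \<Longrightarrow> S \<subseteq> C \<Longrightarrow> S \<noteq> C \<Longrightarrow> \<exists>u\<in>S. \<exists>v\<in>C - S. adj u v"
  shows "conn C"
  unfolding conn_def
proof (intro conjI allI impI)
  show "C \<noteq> {}" using assms by auto
  fix S assume S: "S \<subseteq> C \<and> S \<noteq> {} \<and> S \<noteq> C"
  show "\<exists>u\<in>S. \<exists>v\<in>C - S. adj u v"
  proof (cases "r \<in> S")
    case True then show ?thesis using S assms(2) by blast
  next
    case False
    then have "\<exists>u\<in>C - S. \<exists>v\<in>C - (C - S). adj u v"
      using S assms(1) by (intro assms(2)) auto
    then show ?thesis using adj_sym by blast
  qed
qed

lemma conn_Un:
  assumes "conn A" "conn B" "A \<inter> B \<noteq> {} \<or> (\<exists>a\<in>A. \<exists>b\<in>B. adj a b)"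
  shows "conn (A \<union> B)"
proof -
  obtain r where r: "r \<in> A" using assms by (auto simp: conn_def)
  show ?thesis
  proof (rule connI[of r])
    fix S assume S: "r \<in> S" "S \<subseteq> A \<union> B" "S \<noteq> A \<union> B"
    show "\<exists>u\<in>S. \<exists>v\<in>A \<union> B - S. adj u v"
    proof (cases "A \<subseteq> S")
      case False
      then show ?thesis using conn_cut[OF assms(1) r S(1)] by blast
    next
      case True
      then obtain y where y: "y \<in> B" "y \<notin> S" using S by auto
      show ?thesis
      proof (cases "B \<inter> S = {}")
        case False
        then show ?thesis using conn_cut[OF assms(2) _ _ y] by blast
      next
        case disj: True
        then show ?thesis using assms(3) True by blast
      qed
    qed
  qed (use r in auto)
qed

lemma conn_singleton: "conn {x}"
  by (rule connI[of x]) auto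

lemma conn_insert: "conn C \<Longrightarrow> c \<in> C \<Longrightarrow> adj c v \<Longrightarrow> conn (insert v C)"
  using conn_Un[OF _ conn_singleton[of v], of C] by auto

lemma conn_UN:
  assumes "conn B" "\<And>i. i \<in> I \<Longrightarrow> conn (A i)" "\<And>i. i \<in> I \<Longrightarrow> \<exists>a\<in>A i. \<exists>b\<in>B. adj a b"
  shows "conn (B \<union> (\<Union>i\<in>I. A i))"
proof -
  obtain r where r: "r \<in> B" using assms by (auto simp: conn_def)
  show ?thesis
  proof (rule connI[of r])
    fix S assume S: "r \<in> S" "S \<subseteq> B \<union> (\<Union>i\<in>I. A i)" "S \<noteq> B \<union> (\<Union>i\<in>I. A i)"
    then obtain y where y: "y \<in> B \<union> (\<Union>i\<in>I. A i)" "y \<notin> S" by blast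
    show "\<exists>u\<in>S. \<exists>v\<in>B \<union> (\<Union>i\<in>I. A i) - S. adj u v"
    proof (cases "y \<in> B")
      case True
      then show ?thesis using conn_cut[OF assms(1) r S(1) _ y(2)] by blast
    next
      case False
      then obtain i where i: "i \<in> I" "y \<in> A i" using y by auto
      have "conn (B \<union> A i)"
        using conn_Un[OF assms(1) assms(2)[OF i(1)]] assms(3)[OF i(1)] adj_sym by blast
      from conn_cut[OF this _ S(1) _ y(2)] r i show ?thesis by blast
    qed
  qed (use r in auto)
qed

text \<open>Growing \<open>C\<close> across a cut one vertex at a time brings at least one new edge
  per step. With \<open>C\<close> the vertex set of a cycle it follows that a connected graph
  containing a cycle has at least as many edges as vertices.\<close>

lemma card_inner_connected_ge:
  assumes "finite S" "conn S" "C \<subseteq> S" "C \<noteq> {}"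
  shows "card (inner C) + card (S - C) \<le> card (inner S)"
  using assms(3,4)
proof (induction "card (S - C)" arbitrary: C)
  case 0
  then have "S = C" using assms(1) by auto
  then show ?case by simp
next
  case (Suc n)
  then have "S - C \<noteq> {}" by (metis card.empty nat.distinct(1))
  then obtain y x where "y \<in> S" "y \<notin> C" "x \<in> C" using Suc by auto
  then obtain u v where uv: "u \<in> S" "u \<in> C" "v \<in> S" "v \<notin> C" "adj u v"
    using conn_cut[OF assms(2), of x C y] Suc.prems by blast
  have fin: "finite C" using Suc.prems assms finite_subset by blast
  have "S - insert v C = (S - C) - {v}" by auto
  then have cd: "card (S - C) = Suc (card (S - insert v C))"
    using uv assms(1) by (metis card_Suc_Diff1 Diff_iff finite_Diff)
  have "card (inner (insert v C)) + card (S - insert v C) \<le> card (inner S)"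
  proof (rule Suc.hyps(1))
    show "n = card (S - insert v C)" using Suc.hyps(2) cd by simp
  qed (use Suc.prems uv in auto)
  moreover have "Suc (card (inner C)) \<le> card (inner (insert v C))"
  proof -
    have "{u, v} \<notin> inner C" using uv by (auto simp: inner_def)
    then have "card (insert {u, v} (inner C)) = Suc (card (inner C))"
      using finite_inner[OF fin] by simp
    moreover have "insert {u, v} (inner C) \<subseteq> inner (insert v C)"
      using uv by (auto simp: inner_def adj_def)
    ultimately show ?thesis using card_mono[OF finite_inner, of "insert v C"] fin by (metis finite_insert)
  qed
  ultimately show ?case using cd by linarith
qed

section \<open>Components of induced subgraphs\<close>

definition comps :: "'a set \<Rightarrow> 'a set set" where
  "comps U = {C. conn C \<and> C \<subseteq> U \<and> (\<forall>u\<in>C. \<forall>v\<in>U - C. \<not> adj u v)}"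

lemma comps_subset: "H \<in> comps U \<Longrightarrow> H \<subseteq> U"
  and comps_conn: "H \<in> comps U \<Longrightarrow> conn H"
  and comps_nonempty: "H \<in> comps U \<Longrightarrow> H \<noteq> {}"
  and comps_closed: "H \<in> comps U \<Longrightarrow> u \<in> H \<Longrightarrow> adj u v \<Longrightarrow> v \<in> U \<Longrightarrow> v \<in> H"
  by (auto simp: comps_def conn_def)

lemma conn_subset_comp:
  assumes "conn Z" "Z \<subseteq> U" "H \<in> comps U" "Z \<inter> H \<noteq> {}"
  shows "Z \<subseteq> H"
proof (rule ccontr)
  assume "\<not> Z \<subseteq> H"
  then obtain y where "y \<in> Z" "y \<notin> H" by auto
  moreover obtain x where "x \<in> Z" "x \<in> H" using assms by auto
  ultimately obtain u v where "u \<in> H" "v \<in> Z" "v \<notin> H" "adj u v"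
    using conn_cut[OF assms(1)] by metis
  then show False using assms comps_closed by blast
qed

lemma comps_disjoint:
  assumes "H \<in> comps U" "K \<in> comps U" "H \<noteq> K"
  shows "H \<inter> K = {}"
proof (rule ccontr)
  assume "H \<inter> K \<noteq> {}"
  then have "H \<subseteq> K" "K \<subseteq> H"
    using conn_subset_comp[OF comps_conn[OF assms(1)] comps_subset[OF assms(1)] assms(2)]
      conn_subset_comp[OF comps_conn[OF assms(2)] comps_subset[OF assms(2)] assms(1)] by auto
  then show False using assms(3) by auto
qed

lemma comps_cover:
  assumes "finite U" "u \<in> U"
  obtains H where "H \<in> comps U" "u \<in> H"
proof -
  let ?P = "\<lambda>C. conn C \<and> C \<subseteq> U \<and> u \<in> C"
  have 1: "?P {u}" using assms conn_singleton by auto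
  have "\<forall>C. ?P C \<longrightarrow> card C < Suc (card U)" using assms card_mono by (auto simp: less_Suc_eq_le)
  from ex_has_greatest_nat[of ?P, OF 1 this]
  obtain C where C: "?P C" "\<forall>D. ?P D \<longrightarrow> card D \<le> card C" by auto
  have "\<not> adj c v" if "c \<in> C" "v \<in> U - C" for c v
  proof
    assume "adj c v"
    then have "?P (insert v C)" using that C conn_insert by auto
    then have "card (insert v C) \<le> card C" using C by blast
    moreover have "finite C" using C assms finite_subset by blast
    ultimately show False using that by simp
  qed
  then show thesis using that[of C] C by (auto simp: comps_def)
qed

lemma finite_comps: "finite U \<Longrightarrow> finite (comps U)"
  by (rule finite_subset[of _ "Pow U"]) (auto simp: comps_def)

lemma comp_attached:
  assumes "conn W" "R \<subseteq> W" "R \<noteq> {}" "H \<in> comps (W - R)"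
  obtains h r where "h \<in> H" "r \<in> R" "adj h r"
proof -
  obtain x y where xy: "x \<in> H" "y \<in> R" using assms(3) comps_nonempty[OF assms(4)] by auto
  have sub: "H \<subseteq> W - R" using assms(4) by (rule comps_subset)
  obtain u v where uv: "u \<in> H" "v \<in> W" "v \<notin> H" "adj u v"
    by (rule conn_cut[OF assms(1), of x H y]) (use xy sub assms(2) in auto)
  then have "v \<in> R" using comps_closed[OF assms(4)] by blast
  then show thesis using uv that by blast
qed

text \<open>Edges from \<open>H\<close> to \<open>R\<close> end only in \<open>S\<close>, so putting
  the rest of \<open>R\<close> back does not enlarge \<open>H\<close>. With a singleton
  \<open>S\<close>, a component having just one neighbour turns out to be pendant at a
  vertex.\<close>

lemma comp_of_smaller_removal:
  assumes "H \<in> comps (W - R)" "S \<subseteq> R" "\<And>h r. h \<in> H \<Longrightarrow> r \<in> R \<Longrightarrow> r \<in> W \<Longrightarrow> adj h r \<Longrightarrow> r \<in> S"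
  shows "H \<in> comps (W - S)"
  unfolding comps_def
proof (intro CollectI conjI ballI)
  show "conn H" "H \<subseteq> W - S" using assms(2) comps_conn[OF assms(1)] comps_subset[OF assms(1)] by auto
  show "\<not> adj u v" if "u \<in> H" "v \<in> W - S - H" for u v
    using that comps_closed[OF assms(1), of u v] assms(3)[of u v] by blast
qed


subsection \<open>Four-cycles and isolating sets\<close>

lemma card_inner_Un:
  assumes "finite A" "finite B" "A \<inter> B = {}"
  shows "card (inner A) + card (inner B) + card (between A B) \<le> card (inner (A \<union> B))"
proof -
  have "A \<subseteq> A \<union> B - B" using assms by auto
  then show ?thesis using card_inner_family[of "A \<union> B" "{()}" B "\<lambda>_. A"] assms by simp
qed

text \<open>Chords are allowed, as copies of the cycle need not be induced; \<open>is_C4\<close> and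
  \<open>is_diamond\<close> below prescribe the chords.\<close>

definition cycle4 :: "'a \<Rightarrow> 'a \<Rightarrow> 'a \<Rightarrow> 'a \<Rightarrow> bool" where
  "cycle4 a b c d \<longleftrightarrow> distinct [a, b, c, d] \<and> adj a b \<and> adj b c \<and> adj c d \<and> adj d a"

definition spans_C4 :: "'a set \<Rightarrow> bool" where
  "spans_C4 Z \<longleftrightarrow> (\<exists>a b c d. Z = {a, b, c, d} \<and> cycle4 a b c d)"

definition has_C4 :: "'a set \<Rightarrow> bool" where
  "has_C4 U \<longleftrightarrow> (\<exists>Z \<subseteq> U. spans_C4 Z)"

definition is_C4 :: "'a set \<Rightarrow> bool" where
  "is_C4 Z \<longleftrightarrow> (\<exists>a b c d. Z = {a, b, c, d} \<and> cycle4 a b c d \<and> \<not> adj a c \<and> \<not> adj b d)"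

definition is_diamond :: "'a set \<Rightarrow> bool" where
  "is_diamond Z \<longleftrightarrow> (\<exists>a b c d. Z = {a, b, c, d} \<and> cycle4 a b c d \<and> adj a c \<and> \<not> adj b d)"

lemma cycle4_rotate: "cycle4 a b c d \<Longrightarrow> cycle4 b c d a"
  by (auto simp: cycle4_def)

lemma spans_C4_card: "spans_C4 Z \<Longrightarrow> card Z = 4"
  and spans_C4_finite: "spans_C4 Z \<Longrightarrow> finite Z"
  by (auto simp: spans_C4_def cycle4_def)

lemma is_C4_spans: "is_C4 Z \<Longrightarrow> spans_C4 Z"
  and is_diamond_spans: "is_diamond Z \<Longrightarrow> spans_C4 Z"
  by (auto simp: is_C4_def is_diamond_def spans_C4_def)

lemma spans_C4_at:
  assumes "spans_C4 Z" "z \<in> Z"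
  obtains b c d where "Z = {z, b, c, d}" "cycle4 z b c d"
proof -
  obtain p q r s where Z: "Z = {p, q, r, s}" "cycle4 p q r s"
    using assms by (auto simp: spans_C4_def)
  note rot = cycle4_rotate[OF Z(2)] cycle4_rotate[OF cycle4_rotate[OF Z(2)]]
    cycle4_rotate[OF cycle4_rotate[OF cycle4_rotate[OF Z(2)]]]
  consider "z = p" | "z = q" | "z = r" | "z = s" using assms Z by auto
  then show thesis
  proof cases
    case 1 then show ?thesis using that Z by auto
  next
    case 2 then show ?thesis using that[of r s p] Z rot by auto
  next
    case 3 then show ?thesis using that[of s p q] Z rot by auto
  next
    case 4 then show ?thesis using that[of p q r] Z rot by auto
  qed
qed

lemma is_C4_at:
  assumes "is_C4 Z" "z \<in> Z"
  obtains b c d where "Z = {z, b, c, d}" "cycle4 z b c d" "\<not> adj z c" "\<not> adj b d"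
proof -
  obtain p q r s where Z: "Z = {p, q, r, s}" "cycle4 p q r s" "\<not> adj p r" "\<not> adj q s"
    using assms by (auto simp: is_C4_def)
  note rot = cycle4_rotate[OF Z(2)] cycle4_rotate[OF cycle4_rotate[OF Z(2)]]
    cycle4_rotate[OF cycle4_rotate[OF cycle4_rotate[OF Z(2)]]]
  have n: "\<not> adj r p" "\<not> adj s q" using Z adj_sym by auto
  consider "z = p" | "z = q" | "z = r" | "z = s" using assms Z by auto
  then show thesis
  proof cases
    case 1 then show ?thesis using that Z by auto
  next
    case 2 then show ?thesis using that[of r s p] Z rot n by auto
  next
    case 3 then show ?thesis using that[of s p q] Z rot n by auto
  next
    case 4 then show ?thesis using that[of p q r] Z rot n by auto
  qed
qed

lemma spans_C4_two_neighbours: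
  assumes "spans_C4 Z" "z \<in> Z"
  obtains p q where "p \<in> Z" "q \<in> Z" "p \<noteq> q" "adj z p" "adj z q"
proof -
  obtain b c d where "Z = {z, b, c, d}" "cycle4 z b c d" using assms by (rule spans_C4_at)
  then show thesis using that[of b d] adj_sym by (auto simp: cycle4_def)
qed

text \<open>Walking once around a cycle crosses any cut an even number of times, hence at least
  twice. This is what makes a single remaining connecting edge harmless.\<close>

lemma spans_C4_two_crossings:
  assumes "spans_C4 Z" "Z \<inter> H \<noteq> {}" "\<not> Z \<subseteq> H"
  obtains e f where "e \<noteq> f" "e \<in> E" "e \<subseteq> Z" "e \<inter> H \<noteq> {}" "e - H \<noteq> {}"
    "f \<in> E" "f \<subseteq> Z" "f \<inter> H \<noteq> {}" "f - H \<noteq> {}"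
proof -
  obtain a where "a \<in> Z" "a \<in> H" using assms by auto
  then obtain b c d where Z: "Z = {a, b, c, d}" "cycle4 a b c d" "a \<in> H"
    using spans_C4_at[OF assms(1)] by metis
  then have e: "{a, b} \<in> E" "{b, c} \<in> E" "{c, d} \<in> E" "{d, a} \<in> E"
    and ne: "a \<noteq> b" "a \<noteq> c" "a \<noteq> d" "b \<noteq> c" "b \<noteq> d" "c \<noteq> d"
    by (auto simp: cycle4_def adj_def)
  consider "b \<notin> H" "d \<notin> H" | "b \<notin> H" "c \<notin> H" "d \<in> H" | "b \<notin> H" "c \<in> H" "d \<in> H"
    | "b \<in> H" "c \<notin> H" "d \<notin> H" | "b \<in> H" "c \<in> H" "d \<notin> H" | "b \<in> H" "c \<notin> H" "d \<in> H"
    using assms Z by auto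
  then show thesis
  proof cases
    case 1 then show ?thesis using that[of "{a, b}" "{d, a}"] e ne Z by (auto simp: doubleton_eq_iff)
  next
    case 2 then show ?thesis using that[of "{a, b}" "{c, d}"] e ne Z by (auto simp: doubleton_eq_iff)
  next
    case 3 then show ?thesis using that[of "{a, b}" "{b, c}"] e ne Z by (auto simp: doubleton_eq_iff)
  next
    case 4 then show ?thesis using that[of "{b, c}" "{d, a}"] e ne Z by (auto simp: doubleton_eq_iff)
  next
    case 5 then show ?thesis using that[of "{c, d}" "{d, a}"] e ne Z by (auto simp: doubleton_eq_iff)
  next
    case 6 then show ?thesis using that[of "{b, c}" "{c, d}"] e ne Z by (auto simp: doubleton_eq_iff)
  qed
qed

lemma spans_C4_conn: "spans_C4 Z \<Longrightarrow> conn Z"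
  unfolding conn_def
proof (intro conjI allI impI)
  assume Z: "spans_C4 Z"
  then show "Z \<noteq> {}" by (auto simp: spans_C4_def)
  fix S assume S: "S \<subseteq> Z \<and> S \<noteq> {} \<and> S \<noteq> Z"
  then have S': "Z \<inter> S \<noteq> {}" "\<not> Z \<subseteq> S" by auto
  obtain e where e: "e \<in> E" "e \<subseteq> Z" "e \<inter> S \<noteq> {}" "e - S \<noteq> {}"
    by (rule spans_C4_two_crossings[OF Z S'])
  then obtain u v where "e = {u, v}" "adj u v" by (metis edge_cases)
  then show "\<exists>u\<in>S. \<exists>v\<in>Z - S. adj u v" using e adj_sym by auto
qed

lemma has_C4_mono: "has_C4 U \<Longrightarrow> U \<subseteq> W \<Longrightarrow> has_C4 W"
  by (meson has_C4_def subset_trans)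

lemma not_has_C4_small:
  assumes "finite U" "card U \<le> 3"
  shows "\<not> has_C4 U"
proof
  assume "has_C4 U"
  then obtain Z where Z: "Z \<subseteq> U" "spans_C4 Z" by (auto simp: has_C4_def)
  show False using card_mono[OF assms(1) Z(1)] spans_C4_card[OF Z(2)] assms(2) by simp
qed

lemma card_inner_spans_C4:
  assumes "spans_C4 Z"
  shows "4 \<le> card (inner Z)"
proof -
  obtain a b c d where Z: "Z = {a, b, c, d}" "cycle4 a b c d"
    using assms by (auto simp: spans_C4_def)
  then have "{{a, b}, {b, c}, {c, d}, {d, a}} \<subseteq> inner Z"
    by (auto simp: cycle4_def adj_def inner_def)
  from card_mono[OF finite_inner this] have
    "card {{a, b}, {b, c}, {c, d}, {d, a}} \<le> card (inner Z)" using Z by auto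
  moreover have "card {{a, b}, {b, c}, {c, d}, {d, a}} = 4"
    using Z by (auto simp: cycle4_def doubleton_eq_iff)
  ultimately show ?thesis by simp
qed

lemma inner_four:
  assumes "distinct [a, b, c, d]"
  shows "inner {a, b, c, d} = {e \<in> {{a, b}, {b, c}, {c, d}, {d, a}, {a, c}, {b, d}}. e \<in> E}"
proof (intro set_eqI iffI)
  fix e assume "e \<in> inner {a, b, c, d}"
  then have e: "e \<in> E" "e \<subseteq> {a, b, c, d}" by (auto simp: inner_def)
  obtain u v where "e = {u, v}" "u \<noteq> v" by (rule edge_cases[OF e(1)])
  then show "e \<in> {e \<in> {{a, b}, {b, c}, {c, d}, {d, a}, {a, c}, {b, d}}. e \<in> E}"
    using e by (auto simp: insert_commute)
qed (auto simp: inner_def)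

lemma card_inner_is_C4:
  assumes "is_C4 Z"
  shows "card (inner Z) = 4"
proof -
  obtain a b c d where Z: "Z = {a, b, c, d}" "cycle4 a b c d" "\<not> adj a c" "\<not> adj b d"
    using assms by (auto simp: is_C4_def)
  then have "inner Z = {{a, b}, {b, c}, {c, d}, {d, a}}"
    using inner_four[of a b c d] by (auto simp: cycle4_def adj_def)
  moreover have "card {{a, b}, {b, c}, {c, d}, {d, a}} = 4"
    using Z by (auto simp: cycle4_def doubleton_eq_iff)
  ultimately show ?thesis by simp
qed

lemma card_inner_diamond:
  assumes "is_diamond Z"
  shows "card (inner Z) = 5"
proof -
  obtain a b c d where Z: "Z = {a, b, c, d}" "cycle4 a b c d" "adj a c" "\<not> adj b d"
    using assms by (auto simp: is_diamond_def)
  then have "inner Z = {{a, b}, {b, c}, {c, d}, {d, a}, {a, c}}"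
    using inner_four[of a b c d] by (auto simp: cycle4_def adj_def)
  moreover have "card {{a, b}, {b, c}, {c, d}, {d, a}, {a, c}} = 5"
    using Z by (auto simp: cycle4_def doubleton_eq_iff)
  ultimately show ?thesis by simp
qed

lemma spans_C4_cases:
  assumes "spans_C4 Z"
  obtains "is_C4 Z" | "is_diamond Z" | "6 \<le> card (inner Z)"
proof -
  obtain a b c d where Z: "Z = {a, b, c, d}" "cycle4 a b c d"
    using assms by (auto simp: spans_C4_def)
  consider "\<not> adj a c" "\<not> adj b d" | "adj a c" "\<not> adj b d" | "\<not> adj a c" "adj b d"
    | "adj a c" "adj b d" by auto
  then show thesis
  proof cases
    case 1 then show ?thesis using that Z by (auto simp: is_C4_def)
  next
    case 2 then show ?thesis using that Z by (auto simp: is_diamond_def)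
  next
    case 3
    have "cycle4 b c d a" using Z cycle4_rotate by auto
    moreover have "Z = {b, c, d, a}" "\<not> adj c a" using Z 3 adj_sym by auto
    ultimately have "is_diamond Z" using 3 unfolding is_diamond_def by blast
    then show ?thesis by (rule that)
  next
    case 4
    then have "inner Z = {{a, b}, {b, c}, {c, d}, {d, a}, {a, c}, {b, d}}"
      using Z inner_four[of a b c d] by (auto simp: cycle4_def adj_def)
    moreover have "card {{a, b}, {b, c}, {c, d}, {d, a}, {a, c}, {b, d}} = 6"
      using Z by (auto simp: cycle4_def doubleton_eq_iff)
    ultimately show ?thesis using that by simp
  qed
qed

section \<open>Domination and the accounting of edges\<close>

definition nbhd :: "'a set \<Rightarrow> 'a set" where
  "nbhd D = D \<union> {v. \<exists>u\<in>D. adj u v}"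

lemma nbhd_mono: "A \<subseteq> B \<Longrightarrow> nbhd A \<subseteq> nbhd B"
  by (auto simp: nbhd_def)

text \<open>\<open>nbhd\<close> refers to the whole edge set and may leave \<open>W\<close>; the
  difference cuts it down to \<open>W\<close>, so the same notion serves every induced
  subgraph.\<close>

definition isolates :: "'a set \<Rightarrow> 'a set \<Rightarrow> bool" where
  "isolates D W \<longleftrightarrow> D \<subseteq> W \<and> \<not> has_C4 (W - nbhd D)"

text \<open>The number \<open>k\<close> is the deficit: 0 in the generic case, 1 for extremal graphs, 2 for a four-cycle.\<close>

definition isolable :: "nat \<Rightarrow> 'a set \<Rightarrow> bool" where
  "isolable k W \<longleftrightarrow> (\<exists>D. isolates D W \<and> 6 * card D \<le> card (inner W) + k)"

text \<open>Once \<open>x\<close> is chosen, the component \<open>H\<close> of the rest can be isolated with \<open>s\<close> edges to spare.\<close>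

definition saves :: "'a \<Rightarrow> 'a set \<Rightarrow> 'a set \<Rightarrow> nat \<Rightarrow> bool" where
  "saves x R H s \<longleftrightarrow> (\<exists>D \<subseteq> H. \<not> has_C4 (H - nbhd {x} - nbhd D) \<and>
     6 * card D + s \<le> card (inner H) + card (between H R))"

lemma saves_mono: "saves x R H s \<Longrightarrow> t \<le> s \<Longrightarrow> saves x R H t"
  unfolding saves_def by (meson add_left_mono le_trans)

lemma isolable_saves:
  assumes "isolable k H" "s + k \<le> card (between H R)"
  shows "saves x R H s"
proof -
  obtain D where D: "D \<subseteq> H" "\<not> has_C4 (H - nbhd D)" "6 * card D \<le> card (inner H) + k"
    using assms by (auto simp: isolable_def isolates_def)
  moreover have "\<not> has_C4 (H - nbhd {x} - nbhd D)" using D has_C4_mono by blast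
  ultimately show ?thesis using assms unfolding saves_def by (intro exI[of _ D]) auto
qed

lemma four_minus_nbhd:
  assumes "card H = 4" "H \<inter> nbhd {x} \<noteq> {}"
  shows "\<not> has_C4 (H - nbhd {x})" "card (H - nbhd {x}) \<le> 3"
proof -
  have "finite H" using assms card.infinite by fastforce
  then have "card (H - nbhd {x}) < card H" using assms by (intro psubset_card_mono) auto
  then show "card (H - nbhd {x}) \<le> 3" using assms by simp
  then show "\<not> has_C4 (H - nbhd {x})" using not_has_C4_small \<open>finite H\<close> by blast
qed

text \<open>The centre \<open>x\<close> already hits or dominates a vertex of \<open>H\<close>, and
  fewer than four vertices carry no four-cycle. Nothing is chosen in \<open>H\<close>, so all its
  edges are saved.\<close>

lemma four_saves:
  assumes "card H = 4" "H \<inter> nbhd {x} \<noteq> {}" "s \<le> card (inner H) + card (between H R)"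
  shows "saves x R H s"
proof -
  have "nbhd {} = {}" by (simp add: nbhd_def)
  then show ?thesis unfolding saves_def
    using four_minus_nbhd(1)[OF assms(1,2)] assms(3) by (intro exI[of _ "{}"]) simp
qed

text \<open>The isolating set consists of \<open>x\<close> and the sets provided by the components.
  By \<open>notouch\<close> a surviving four-cycle avoids \<open>R\<close> and, being connected,
  lies in one component. In the count, the six edges charged for \<open>x\<close> must come from the
  edges inside \<open>R\<close>, from the deficit \<open>k\<close> and from savings. A positive
  saving is credited to at most one component, which is enough in every case below.\<close>

theorem isolable_by_removal:
  assumes "finite W" "R \<subseteq> W" "x \<in> R"
    and notouch: "\<And>Z. spans_C4 Z \<Longrightarrow> Z \<subseteq> W - nbhd {x} \<Longrightarrow> Z \<inter> R = {}"
    and comps: "\<And>H. H \<in> comps (W - R) \<Longrightarrow> saves x R H 0"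
    and gain: "6 \<le> card (inner R) + k \<or>
      (\<exists>H\<in>comps (W - R). \<exists>s. saves x R H s \<and> 6 \<le> card (inner R) + s + k)"
  shows "isolable k W"
proof -
  let ?I = "comps (W - R)"
  have fI: "finite ?I" using assms finite_comps by auto
  obtain f where f: "\<And>H. H \<in> ?I \<Longrightarrow> saves x R H (f H)" "6 \<le> card (inner R) + sum f ?I + k"
  proof (cases "6 \<le> card (inner R) + k")
    case True
    then show ?thesis using that[of "\<lambda>_. 0"] comps by auto
  next
    case False
    then obtain K s where K: "K \<in> ?I" "saves x R K s" "6 \<le> card (inner R) + s + k"
      using gain by auto
    show ?thesis
    proof (rule that[of "\<lambda>H. if H = K then s else 0"])
      show "saves x R H (if H = K then s else 0)" if "H \<in> ?I" for H using that K comps by simp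
      show "6 \<le> card (inner R) + (\<Sum>H\<in>?I. if H = K then s else 0) + k" using K fI by simp
    qed
  qed
  have "\<forall>H\<in>?I. \<exists>D. D \<subseteq> H \<and> \<not> has_C4 (H - nbhd {x} - nbhd D) \<and>
     6 * card D + f H \<le> card (inner H) + card (between H R)"
    using f unfolding saves_def by blast
  from bchoice[OF this] obtain D where D:
    "\<And>H. H \<in> ?I \<Longrightarrow> D H \<subseteq> H" "\<And>H. H \<in> ?I \<Longrightarrow> \<not> has_C4 (H - nbhd {x} - nbhd (D H))"
    "\<And>H. H \<in> ?I \<Longrightarrow> 6 * card (D H) + f H \<le> card (inner H) + card (between H R)" by blast
  let ?D = "{x} \<union> (\<Union>H\<in>?I. D H)"
  have sub: "H \<subseteq> W - R" if "H \<in> ?I" for H using that comps_subset by blast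
  have "isolates ?D W"
    unfolding isolates_def has_C4_def
  proof (intro conjI notI)
    show "?D \<subseteq> W" using assms D sub by blast
    assume "\<exists>Z \<subseteq> W - nbhd ?D. spans_C4 Z"
    then obtain Z where Z: "Z \<subseteq> W - nbhd ?D" "spans_C4 Z" by auto
    then have "Z \<subseteq> W - nbhd {x}" using nbhd_mono[of "{x}" ?D] by auto
    then have ZR: "Z \<subseteq> W - R" using notouch Z by auto
    obtain z where z: "z \<in> Z" using Z(2) by (auto simp: spans_C4_def)
    obtain H where H: "H \<in> ?I" "z \<in> H"
      using comps_cover[of "W - R" z] ZR z assms by auto
    then have "Z \<subseteq> H" using conn_subset_comp[OF spans_C4_conn[OF Z(2)] ZR H(1)] z by auto
    moreover have "nbhd (D H) \<subseteq> nbhd ?D" using H by (intro nbhd_mono) auto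
    moreover have "nbhd {x} \<subseteq> nbhd ?D" by (intro nbhd_mono) auto
    ultimately have "Z \<subseteq> H - nbhd {x} - nbhd (D H)" using Z by blast
    then show False using D(2)[OF H(1)] Z by (auto simp: has_C4_def)
  qed
  moreover have "6 * card ?D \<le> card (inner W) + k"
  proof -
    have "finite (D H)" if "H \<in> ?I" for H
      using that D(1) sub assms(1) by (meson Diff_subset finite_subset)
    then have "card ?D \<le> 1 + (\<Sum>H\<in>?I. card (D H))"
      using card_Un_le[of "{x}" "\<Union>H\<in>?I. D H"] card_UN_le[OF fI, of D] by simp
    moreover have "(\<Sum>H\<in>?I. 6 * card (D H) + f H) \<le> (\<Sum>H\<in>?I. card (inner H) + card (between H R))"
      using D(3) by (intro sum_mono) auto
    moreover have "card (inner R) + (\<Sum>H\<in>?I. card (inner H) + card (between H R)) \<le> card (inner W)"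
      using card_inner_family[OF assms(1) fI assms(2), of "\<lambda>H. H"] sub comps_disjoint by blast
    ultimately show ?thesis using f(2) by (simp add: sum.distrib sum_distrib_left[symmetric])
  qed
  ultimately show ?thesis unfolding isolable_def by blast
qed

text \<open>Too few vertices of \<open>H\<close> survive for a four-cycle inside \<open>H\<close>,
  and one that leaves \<open>H\<close> needs two crossing edges outside
  \<open>nbhd {x}\<close>.\<close>

lemma bridge_not_in_C4:
  assumes "finite W" "finite H" "card (H - nbhd {x}) \<le> 3"
    and few: "card {e \<in> E. e \<subseteq> W - nbhd {x} \<and> e \<inter> H \<noteq> {} \<and> e - H \<noteq> {}} \<le> 1"
    and Z: "spans_C4 Z" "Z \<subseteq> W - nbhd {x}"
  shows "Z \<inter> H = {}"
proof (rule ccontr)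
  assume ne: "Z \<inter> H \<noteq> {}"
  show False
  proof (cases "Z \<subseteq> H")
    case True
    then have "card Z \<le> card (H - nbhd {x})" using Z assms(2) by (intro card_mono) auto
    then show False using assms(3) spans_C4_card[OF Z(1)] by simp
  next
    case False
    let ?B = "{e \<in> E. e \<subseteq> W - nbhd {x} \<and> e \<inter> H \<noteq> {} \<and> e - H \<noteq> {}}"
    have fB: "finite ?B" by (rule finite_subset[of _ "Pow W"]) (use assms in auto)
    obtain e f where ef: "e \<noteq> f" "e \<in> E" "e \<subseteq> Z" "e \<inter> H \<noteq> {}" "e - H \<noteq> {}"
      "f \<in> E" "f \<subseteq> Z" "f \<inter> H \<noteq> {}" "f - H \<noteq> {}"
      by (rule spans_C4_two_crossings[OF Z(1) ne False])
    then have "{e, f} \<subseteq> ?B" using Z(2) by auto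
    from card_mono[OF fB this] show False using few ef(1) by simp
  qed
qed


subsection \<open>Pendant extremal pieces\<close>

text \<open>Here \<open>T\<close> is the vertex set of the tree and \<open>Q t\<close> the copy of the four-cycle belonging to \<open>t\<close>. That \<open>T\<close>
  is acyclic is left to the edge count in \<open>is_cons\<close>.\<close>

definition cons_shape :: "'a set \<Rightarrow> 'a set \<Rightarrow> ('a \<Rightarrow> 'a set) \<Rightarrow> bool" where
  "cons_shape W T Q \<longleftrightarrow> conn T \<and> W = T \<union> (\<Union>t\<in>T. Q t) \<and>
     (\<forall>t\<in>T. is_C4 (Q t) \<and> Q t \<inter> T = {}) \<and>
     (\<forall>s\<in>T. \<forall>t\<in>T. s \<noteq> t \<longrightarrow> Q s \<inter> Q t = {}) \<and>
     (\<forall>t\<in>T. \<exists>q\<in>Q t. adj t q \<and> (\<forall>u\<in>Q t. \<forall>v\<in>W - Q t. adj u v \<longrightarrow> u = q \<and> v = t))"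

definition is_cons :: "'a set \<Rightarrow> bool" where
  "is_cons W \<longleftrightarrow> (\<exists>T Q. cons_shape W T Q \<and> card (inner W) + 1 = 6 * card T)"

definition tight :: "'a set \<Rightarrow> bool" where
  "tight W \<longleftrightarrow> is_diamond W \<or> is_cons W"

lemma cons_shapeD:
  assumes "cons_shape W T Q"
  shows "conn T" "T \<subseteq> W" "W = T \<union> (\<Union>t\<in>T. Q t)"
    and "\<And>t. t \<in> T \<Longrightarrow> is_C4 (Q t)" "\<And>t. t \<in> T \<Longrightarrow> Q t \<inter> T = {}" "\<And>t. t \<in> T \<Longrightarrow> Q t \<subseteq> W"
    and "\<And>s t. s \<in> T \<Longrightarrow> t \<in> T \<Longrightarrow> s \<noteq> t \<Longrightarrow> Q s \<inter> Q t = {}"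
proof -
  note c = assms[unfolded cons_shape_def]
  show "conn T" "W = T \<union> (\<Union>t\<in>T. Q t)" using c by blast+
  then show "T \<subseteq> W" "\<And>t. t \<in> T \<Longrightarrow> Q t \<subseteq> W" by blast+
  show "\<And>t. t \<in> T \<Longrightarrow> is_C4 (Q t)" "\<And>t. t \<in> T \<Longrightarrow> Q t \<inter> T = {}" using c by blast+
  show "\<And>s t. s \<in> T \<Longrightarrow> t \<in> T \<Longrightarrow> s \<noteq> t \<Longrightarrow> Q s \<inter> Q t = {}" using c by blast
qed

lemma cons_attachment:
  assumes "cons_shape W T Q" "t \<in> T"
  obtains q where "q \<in> Q t" "adj t q"
    "\<And>u v. u \<in> Q t \<Longrightarrow> v \<in> W \<Longrightarrow> v \<notin> Q t \<Longrightarrow> adj u v \<Longrightarrow> u = q \<and> v = t"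
proof -
  have "\<exists>q\<in>Q t. adj t q \<and> (\<forall>u\<in>Q t. \<forall>v\<in>W - Q t. adj u v \<longrightarrow> u = q \<and> v = t)"
    using assms unfolding cons_shape_def by blast
  then obtain q where "q \<in> Q t" "adj t q" "\<forall>u\<in>Q t. \<forall>v\<in>W - Q t. adj u v \<longrightarrow> u = q \<and> v = t" by blast
  then show thesis by (intro that[of q]) simp_all
qed

text \<open>With \<open>t\<close> chosen, the attachment vertex \<open>q\<close> is dominated as
  well, so the only edge leaving \<open>Q t\<close> is gone. A surviving four-cycle meeting the copy
  would have to fit into its three other vertices.\<close>

lemma cons_dominated_copy:
  assumes cons: "cons_shape W T Q" "t \<in> T" "t \<in> D"
    and Z: "spans_C4 Z" "Z \<subseteq> W - nbhd D"
  shows "Z \<inter> Q t = {}"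
proof (rule ccontr)
  obtain q where q: "q \<in> Q t" "adj t q"
    "\<And>u v. u \<in> Q t \<Longrightarrow> v \<in> W \<Longrightarrow> v \<notin> Q t \<Longrightarrow> adj u v \<Longrightarrow> u = q \<and> v = t"
    by (rule cons_attachment[OF cons(1,2)]) (rule that, blast+)
  assume "Z \<inter> Q t \<noteq> {}"
  then obtain z where z: "z \<in> Z" "z \<in> Q t" by auto
  have out: "t \<notin> Z" "q \<notin> Z" using Z(2) cons(3) q(2) by (auto simp: nbhd_def)
  have "Z \<subseteq> Q t"
  proof
    fix y assume y: "y \<in> Z"
    show "y \<in> Q t"
    proof (rule ccontr)
      assume "y \<notin> Q t"
      from conn_cut[OF spans_C4_conn[OF Z(1)] z y this]
      obtain u v where "u \<in> Z" "u \<in> Q t" "v \<in> Z" "v \<notin> Q t" "adj u v" .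
      then show False using q(3)[of u v] out Z(2) by auto
    qed
  qed
  moreover have Qt: "spans_C4 (Q t)" using cons_shapeD(4)[OF cons(1,2)] by (rule is_C4_spans)
  ultimately have "card Z < card (Q t)"
    using q(1) out spans_C4_finite by (intro psubset_card_mono) auto
  then show False using spans_C4_card[OF Z(1)] spans_C4_card[OF Qt] by simp
qed

lemma cons_isolates:
  assumes "cons_shape W T Q"
  shows "isolates T W"
  unfolding isolates_def has_C4_def
proof (intro conjI notI)
  show "T \<subseteq> W" using assms by (rule cons_shapeD)
  assume "\<exists>Z \<subseteq> W - nbhd T. spans_C4 Z"
  then obtain Z where Z: "Z \<subseteq> W - nbhd T" "spans_C4 Z" by auto
  obtain z where z: "z \<in> Z" using Z(2) by (auto simp: spans_C4_def)
  then have "z \<in> W" "z \<notin> T" using Z(1) by (auto simp: nbhd_def)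
  then obtain t where "t \<in> T" "z \<in> Q t" using cons_shapeD(3)[OF assms] by auto
  then show False using cons_dominated_copy[OF assms _ _ Z(2,1)] z by blast
qed

text \<open>This is why a touched member of the family is cheap: \<open>P\<close> takes away a
  vertex of the copy at \<open>t\<close>, and \<open>t\<close> can be spared. The other copies are
  settled by their tree vertices; a surviving four-cycle lies in \<open>insert t (Q t)\<close>,
  where \<open>t\<close> has only one neighbour and thus lies on no cycle.\<close>

lemma cons_isolates_but_one:
  assumes cons: "cons_shape W T Q" and t: "t \<in> T" "Q t \<inter> P \<noteq> {}"
  shows "\<not> has_C4 (W - P - nbhd (T - {t}))"
proof
  assume "has_C4 (W - P - nbhd (T - {t}))"
  then obtain Z where Z: "Z \<subseteq> W - P - nbhd (T - {t})" "spans_C4 Z" by (auto simp: has_C4_def)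
  obtain q where q: "\<And>u v. u \<in> Q t \<Longrightarrow> v \<in> W \<Longrightarrow> v \<notin> Q t \<Longrightarrow> adj u v \<Longrightarrow> u = q \<and> v = t"
    by (rule cons_attachment[OF cons t(1)]) (rule that, blast+)
  have Qt: "is_C4 (Q t)" "t \<notin> Q t" using cons_shapeD(4,5)[OF cons t(1)] t(1) by auto
  have sub: "Z \<subseteq> insert t (Q t)"
  proof
    fix z assume z: "z \<in> Z"
    then have "z \<in> W" "z \<notin> T - {t}" using Z(1) by (auto simp: nbhd_def)
    moreover have "z \<notin> Q s" if "s \<in> T" "s \<noteq> t" for s
      using cons_dominated_copy[OF cons that(1) _ Z(2), of "T - {t}"] Z(1) that z by blast
    ultimately show "z \<in> insert t (Q t)" using cons_shapeD(3)[OF cons] by auto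
  qed
  show False
  proof (cases "t \<in> Z")
    case True
    obtain p r where "p \<in> Z" "r \<in> Z" "p \<noteq> r" "adj t p" "adj t r"
      using spans_C4_two_neighbours[OF Z(2) True] .
    moreover have "x = q" if "x \<in> Z" "adj t x" for x
    proof -
      have "x \<in> Q t" "adj x t" "t \<in> W"
        using sub that not_adj_self adj_sym t(1) cons_shapeD(2)[OF cons] by blast+
      then show ?thesis using q[of x t] Qt(2) by blast
    qed
    ultimately show False by auto
  next
    case False
    then have "Z \<subset> Q t" using sub Z(1) t(2) by blast
    then have "card Z < card (Q t)"
      using spans_C4_finite[OF is_C4_spans[OF Qt(1)]] by (intro psubset_card_mono)
    then show False using spans_C4_card[OF Z(2)] spans_C4_card[OF is_C4_spans[OF Qt(1)]] by simp
  qed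
qed

text \<open>Within \<open>H\<close> a copy sends out only its edge to \<open>t\<close>; if it has
  none to \<open>R\<close> either, deleting \<open>t\<close> cuts it off. An untouched copy is
  thereby exposed as a pendant four-cycle.\<close>

lemma cons_copy_is_comp:
  assumes cons: "cons_shape H T Q" and t: "t \<in> T" and H: "H \<in> comps (W - R)"
    and free: "\<And>u r. u \<in> Q t \<Longrightarrow> r \<in> R \<Longrightarrow> r \<in> W \<Longrightarrow> \<not> adj u r"
  shows "Q t \<in> comps (W - {t})"
  unfolding comps_def
proof (intro CollectI conjI ballI)
  obtain q where q: "\<And>u v. u \<in> Q t \<Longrightarrow> v \<in> H \<Longrightarrow> v \<notin> Q t \<Longrightarrow> adj u v \<Longrightarrow> u = q \<and> v = t"
    by (rule cons_attachment[OF cons t]) (rule that, blast+)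
  have Qt: "is_C4 (Q t)" "t \<notin> Q t" "Q t \<subseteq> H" using cons_shapeD(4,5,6)[OF cons t] t by auto
  show "conn (Q t)" using Qt spans_C4_conn is_C4_spans by auto
  show "Q t \<subseteq> W - {t}" using Qt comps_subset[OF H] by auto
  fix u v assume uv: "u \<in> Q t" "v \<in> W - {t} - Q t"
  show "\<not> adj u v"
  proof
    assume a: "adj u v"
    show False
    proof (cases "v \<in> R")
      case True then show False using free[OF uv(1)] uv a by auto
    next
      case False
      then have "v \<in> H" using comps_closed[OF H _ a] uv Qt by auto
      then show False using q[OF uv(1) _ _ a] uv by auto
    qed
  qed
qed

text \<open>Choosing all of \<open>T\<close> except \<open>t\<close> costs
  \<open>6 * card T - 6\<close>, while \<open>H\<close> has \<open>6 * card T - 1\<close> edges: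
  hence the five on top of the connecting edges.\<close>

lemma cons_saves:
  assumes cons: "cons_shape H T Q" "card (inner H) + 1 = 6 * card T"
    and t: "t \<in> T" "Q t \<inter> nbhd {x} \<noteq> {}" and s: "s \<le> card (between H R) + 5" and fin: "finite H"
  shows "saves x R H s"
  unfolding saves_def
proof (intro exI[of _ "T - {t}"] conjI)
  show "T - {t} \<subseteq> H" using cons_shapeD(2)[OF cons(1)] by auto
  then have "finite T" using fin cons_shapeD(2)[OF cons(1)] finite_subset by auto
  then have "card T = Suc (card (T - {t}))" using t(1) by (metis card_Suc_Diff1)
  then show "6 * card (T - {t}) + s \<le> card (inner H) + card (between H R)" using cons(2) s by simp
qed (use cons_isolates_but_one[OF cons(1) t] in auto)

lemma tight_isolable:
  assumes "tight W"
  shows "isolable 1 W"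
proof (cases "is_diamond W")
  case True
  have W: "card W = 4" "card (inner W) = 5"
    using spans_C4_card[OF is_diamond_spans[OF True]] card_inner_diamond[OF True] by auto
  then obtain a where a: "a \<in> W" by fastforce
  then have "\<not> has_C4 (W - nbhd {a})" using W by (intro four_minus_nbhd(1)) (auto simp: nbhd_def)
  then have "isolates {a} W" using a by (simp add: isolates_def)
  then show ?thesis unfolding isolable_def using W by (intro exI[of _ "{a}"]) simp
next
  case False
  then obtain T Q where "cons_shape W T Q" "card (inner W) + 1 = 6 * card T"
    using assms by (auto simp: tight_def is_cons_def)
  then show ?thesis using cons_isolates unfolding isolable_def by (intro exI[of _ T]) simp
qed

lemma is_C4_isolable:
  assumes "is_C4 W"
  shows "isolable 2 W"
proof -
  have W: "card W = 4" "card (inner W) = 4"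
    using spans_C4_card[OF is_C4_spans[OF assms]] card_inner_is_C4[OF assms] by auto
  then obtain a where a: "a \<in> W" by fastforce
  then have "\<not> has_C4 (W - nbhd {a})" using W by (intro four_minus_nbhd(1)) (auto simp: nbhd_def)
  then have "isolates {a} W" using a by (simp add: isolates_def)
  then show ?thesis unfolding isolable_def using W by (intro exI[of _ "{a}"]) simp
qed

section \<open>Vertices that cut off a four-cycle or an extremal component\<close>

definition classified :: "'a set \<Rightarrow> bool" where
  "classified W \<longleftrightarrow> is_C4 W \<or> isolable 0 W \<or> tight W"

lemma comps_psubset: "H \<in> comps (W - R) \<Longrightarrow> x \<in> R \<Longrightarrow> R \<subseteq> W \<Longrightarrow> H \<subset> W"
  using comps_subset by blast

lemma between_pos:
  assumes "finite W" "conn W" "R \<subseteq> W" "R \<noteq> {}" "H \<in> comps (W - R)"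
  shows "1 \<le> card (between H R)"
proof -
  obtain h r where "h \<in> H" "r \<in> R" "adj h r" using comp_attached assms(2-5) .
  then have "{h, r} \<in> between H R" by (rule edge_in_between[rotated 1])
  moreover have "finite (between H R)"
    using finite_between comps_subset[OF assms(5)] assms(1,3) by (meson Diff_subset finite_subset)
  ultimately show ?thesis by (metis One_nat_def Suc_leI card_gt_0_iff empty_iff)
qed

text \<open>The removed set \<open>insert x C\<close> spans at least five edges, so one further edge
  saved anywhere suffices. If none is saved, all slack is gone: \<open>x\<close> has a single edge
  to \<open>C\<close>, and every other component is a family member with a single edge to
  \<open>x\<close> that misses its copies. Then \<open>x\<close>, with \<open>C\<close> as its copy,
  joins the trees of these components into one tree.\<close>

lemma pendant_C4:
  assumes fin: "finite W" and conn: "conn W"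
    and IH: "\<And>H. H \<subset> W \<Longrightarrow> conn H \<Longrightarrow> classified H"
    and x: "x \<in> W" and C: "C \<in> comps (W - {x})" "is_C4 C"
  shows "isolable 0 W \<or> is_cons W"
proof (rule disjCI)
  assume "\<not> is_cons W"
  show "isolable 0 W"
  proof (rule ccontr)
    assume no: "\<not> isolable 0 W"
    define R where "R = insert x C"
    let ?I = "comps (W - R)"
    have CW: "C \<subseteq> W - {x}" using C(1) by (rule comps_subset)
    have R: "R \<subseteq> W" "x \<in> R" using x CW by (auto simp: R_def)
    have finR: "finite R" "finite C" using fin R finite_subset unfolding R_def by auto
    obtain c where c: "c \<in> C" "adj c x"
      using comp_attached[OF conn _ _ C(1)] x by auto
    have Cx: "C \<inter> nbhd {x} \<noteq> {}" using c adj_sym by (auto simp: nbhd_def)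
    have C4: "card C = 4" using C(2) is_C4_spans spans_C4_card by auto
    have notouch: "Z \<inter> R = {}" if Z: "spans_C4 Z" "Z \<subseteq> W - nbhd {x}" for Z
    proof (rule ccontr)
      assume "Z \<inter> R \<noteq> {}"
      moreover have "x \<notin> Z" using Z by (auto simp: nbhd_def)
      ultimately have "Z \<inter> C \<noteq> {}" "Z \<subseteq> W - {x}" using Z by (auto simp: R_def)
      then have "Z \<subseteq> C" using conn_subset_comp[OF spans_C4_conn[OF Z(1)] _ C(1)] by auto
      then have "has_C4 (C - nbhd {x})" using Z unfolding has_C4_def by blast
      then show False using four_minus_nbhd(1)[OF C4 Cx] by auto
    qed
    have comp: "H \<in> comps (W - {x})" "H \<subseteq> W - R" "conn H" if "H \<in> ?I" for H
    proof -
      show 1: "H \<subseteq> W - R" "conn H" using that comps_subset comps_conn by auto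
      show "H \<in> comps (W - {x})"
      proof (rule comp_of_smaller_removal[OF that])
        fix h r assume hr: "h \<in> H" "r \<in> R" "adj h r"
        show "r \<in> {x}"
        proof (rule ccontr)
          assume "r \<notin> {x}"
          then have "r \<in> C" using hr by (auto simp: R_def)
          then have "h \<in> C" using comps_closed[OF C(1), of r h] hr adj_sym 1 R by auto
          then show False using hr 1 by (auto simp: R_def)
        qed
      qed (use R in auto)
    qed
    have pos: "1 \<le> card (between H R)" if "H \<in> ?I" for H
      using between_pos[OF fin conn R(1) _ that] R by auto
    have touch: "\<exists>h\<in>H. adj h x" if "H \<in> ?I" for H
      using comp_attached[OF conn _ _ comp(1)[OF that]] x by auto
    \<comment> \<open>Four-cycles and diamonds touched by \<open>x\<close> cost no vertex, and
      without deficit one connecting edge is saved. Only a family member can fail to save an edge,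
      and even there a second connecting edge, or a copy met by \<open>nbhd {x}\<close>, would
      provide it.\<close>
    have saves: "saves x R H 1 \<or> saves x R H 0 \<and> card (between H R) = 1 \<and>
        (\<exists>T Q. cons_shape H T Q \<and> card (inner H) + 1 = 6 * card T \<and> (\<forall>t\<in>T. Q t \<inter> nbhd {x} = {}))"
      if H: "H \<in> ?I" for H
    proof -
      have Hx: "H \<inter> nbhd {x} \<noteq> {}" using touch[OF H] adj_sym by (auto simp: nbhd_def)
      have finH: "finite H" using comp(2)[OF H] fin by (meson Diff_subset finite_subset)
      have "classified H" using IH comps_psubset[OF H R(2,1)] comp(3)[OF H] by auto
      then consider "is_C4 H" | "isolable 0 H" | "is_diamond H" | "is_cons H"
        by (auto simp: classified_def tight_def)
      then show ?thesis
      proof cases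
        case 1
        then have "saves x R H 1" using spans_C4_card is_C4_spans card_inner_is_C4 Hx
          by (intro four_saves) auto
        then show ?thesis ..
      next
        case 2
        then show ?thesis using isolable_saves pos[OF H] by auto
      next
        case 3
        then have "saves x R H 1" using spans_C4_card is_diamond_spans card_inner_diamond Hx
          by (intro four_saves) auto
        then show ?thesis ..
      next
        case 4
        then obtain T Q where TQ: "cons_shape H T Q" "card (inner H) + 1 = 6 * card T"
          by (auto simp: is_cons_def)
        have i: "isolable 1 H" using tight_isolable 4 by (auto simp: tight_def)
        show ?thesis
        proof (cases "card (between H R) = 1 \<and> (\<forall>t\<in>T. Q t \<inter> nbhd {x} = {})")
          case True
          then show ?thesis using isolable_saves[OF i, of 0 R x] TQ by auto
        next
          case False
          then consider "card (between H R) \<ge> 2" | t where "t \<in> T" "Q t \<inter> nbhd {x} \<noteq> {}"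
            using pos[OF H] by force
          then have "saves x R H 1"
          proof cases
            case 1 then show ?thesis using isolable_saves[OF i, of 1 R x] by simp
          next
            case 2 then show ?thesis using cons_saves[OF TQ _ _ _ finH, of _ x 1 R] by simp
          qed
          then show ?thesis ..
        qed
      qed
    qed
    have inR: "card (inner R) \<ge> 4 + card (between {x} C)"
    proof -
      have "x \<notin> C" using CW by auto
      then show ?thesis using card_inner_Un[of "{x}" C] finR card_inner_is_C4[OF C(2)]
        by (simp add: R_def)
    qed
    have xc: "{x, c} \<in> between {x} C" using c adj_sym by (intro edge_in_between) auto
    have finb: "finite (between {x} C)" using finite_between finR by auto
    have pos1: "card (between {x} C) \<ge> 1" using xc finb by (metis One_nat_def Suc_leI card_gt_0_iff empty_iff)
    have s0: "saves x R H 0" if "H \<in> ?I" for H using saves[OF that] saves_mono by blast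
    have ng: "\<not> (6 \<le> card (inner R) + 0 \<or> (\<exists>H\<in>?I. \<exists>s. saves x R H s \<and> 6 \<le> card (inner R) + s + 0))"
      using isolable_by_removal[OF fin R notouch s0, of 0] no by blast
    \<comment> \<open>A second edge between \<open>x\<close> and \<open>C\<close> would be the sixth
      edge inside \<open>R\<close>.\<close>
    then have b1: "card (between {x} C) = 1" using inR pos1 by linarith
    have n1: "\<not> saves x R H 1" if "H \<in> ?I" for H
    proof
      assume "saves x R H 1"
      moreover have "6 \<le> card (inner R) + 1 + 0" using inR pos1 by linarith
      ultimately show False using ng that by blast
    qed
    have uniq: "u = c" if "u \<in> C" "adj u x" for u
    proof -
      have "{x, u} \<in> between {x} C" using that adj_sym by (intro edge_in_between) auto
      then have "{x, u} = {x, c}" using xc b1 by (metis card_1_singletonE singletonD)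
      then show ?thesis by (auto simp: doubleton_eq_iff)
    qed
    have "\<forall>H\<in>?I. \<exists>TQ. cons_shape H (fst TQ) (snd TQ) \<and> card (inner H) + 1 = 6 * card (fst TQ) \<and>
        (\<forall>t\<in>fst TQ. (snd TQ) t \<inter> nbhd {x} = {})"
      using saves n1 by fastforce
    from bchoice[OF this] obtain F where F: "\<And>H. H \<in> ?I \<Longrightarrow> cons_shape H (fst (F H)) (snd (F H))"
      "\<And>H. H \<in> ?I \<Longrightarrow> card (inner H) + 1 = 6 * card (fst (F H))"
      "\<And>H t. H \<in> ?I \<Longrightarrow> t \<in> fst (F H) \<Longrightarrow> (snd (F H)) t \<inter> nbhd {x} = {}" by blast
    define TT where "TT = (\<lambda>H. fst (F H))"
    \<comment> \<open>A tree vertex lies in exactly one component, so the copies of all components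
      can be merged into the single function \<open>Q\<close>.\<close>
    define h where "h = (\<lambda>t. SOME H. H \<in> ?I \<and> t \<in> H)"
    define T where "T = {x} \<union> (\<Union>H\<in>?I. TT H)"
    define Q where "Q = (\<lambda>t. if t = x then C else snd (F (h t)) t)"
    have TH: "TT H \<subseteq> H" if "H \<in> ?I" for H using cons_shapeD(2)[OF F(1)[OF that]] by (simp add: TT_def)
    have h: "h t = H" if "H \<in> ?I" "t \<in> H" for t H
      unfolding h_def
    proof (rule some_equality)
      fix K assume "K \<in> ?I \<and> t \<in> K"
      then show "K = H" using that comps_disjoint[of K "W - R" H] by auto
    qed (use that in auto)
    have xT: "x \<notin> H" if "H \<in> ?I" for H using comp(2)[OF that] R by auto
    have Qx: "Q x = C" by (simp add: Q_def)
    have QH: "Q t = snd (F H) t" if "H \<in> ?I" "t \<in> TT H" for t H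
      using h[OF that(1)] TH[OF that(1)] that xT[OF that(1)] by (auto simp: Q_def)
    have shape: "cons_shape H (TT H) Q" if H: "H \<in> ?I" for H
    proof -
      have "cons_shape H (TT H) (snd (F H))" using F(1)[OF H] by (simp add: TT_def)
      then show ?thesis using QH[OF H] unfolding cons_shape_def by auto
    qed
    have Qn: "Q t \<inter> nbhd {x} = {}" if "H \<in> ?I" "t \<in> TT H" for t H
      using F(3)[OF that(1)] that QH[OF that] by (auto simp: TT_def)
    have Tcases: "t = x \<or> (\<exists>H\<in>?I. t \<in> TT H)" if "t \<in> T" for t using that by (auto simp: T_def)
    have WR: "W = R \<union> \<Union> ?I"
    proof -
      have "w \<in> R \<union> \<Union> ?I" if "w \<in> W" for w
        using comps_cover[of "W - R" w] that fin by (metis DiffI UnCI UnionI finite_Diff)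
      then show ?thesis using R comp(2) by blast
    qed
    have "cons_shape W T Q"
      unfolding cons_shape_def
    proof (intro conjI ballI impI)
      show "conn T" unfolding T_def
      proof (rule conn_UN[OF conn_singleton])
        fix H assume H: "H \<in> ?I"
        show "conn (TT H)" using cons_shapeD(1)[OF shape[OF H]] .
        obtain y where y: "y \<in> H" "adj y x" using touch[OF H] by auto
        \<comment> \<open>No copy meets \<open>nbhd {x}\<close>, so the neighbour of
          \<open>x\<close> in \<open>H\<close> is a tree vertex.\<close>
        have "y \<notin> Q t" if "t \<in> TT H" for t
          using Qn[OF H that] y adj_sym by (auto simp: nbhd_def)
        then have "y \<in> TT H" using y(1) cons_shapeD(3)[OF shape[OF H]] by auto
        then show "\<exists>a\<in>TT H. \<exists>b\<in>{x}. adj a b" using y by auto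
      qed
      have "\<Union> ?I = (\<Union>H\<in>?I. TT H \<union> (\<Union>t\<in>TT H. Q t))"
        using cons_shapeD(3)[OF shape] by auto
      then show "W = T \<union> \<Union> (Q ` T)" using WR Qx by (auto simp: T_def R_def)
    next
      fix t assume t: "t \<in> T"
      from Tcases[OF t] show "is_C4 (Q t)" using C(2) Qx cons_shapeD(4)[OF shape] by auto
      from Tcases[OF t] show "Q t \<inter> T = {}"
      proof
        assume "t = x"
        then show ?thesis using Qx CW TH comp(2) by (fastforce simp: T_def R_def)
      next
        assume "\<exists>H\<in>?I. t \<in> TT H"
        then obtain H where H: "H \<in> ?I" "t \<in> TT H" by auto
        have QtH: "Q t \<subseteq> H" using cons_shapeD(6)[OF shape[OF H(1)] H(2)] .
        have "Q t \<inter> TT K = {}" if "K \<in> ?I" for K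
        proof (cases "K = H")
          case True then show ?thesis using cons_shapeD(5)[OF shape[OF H(1)] H(2)] by auto
        next
          case False
          then show ?thesis using comps_disjoint[OF that H(1)] TH[OF that] QtH by auto
        qed
        then show ?thesis using QtH xT[OF H(1)] by (auto simp: T_def)
      qed
      from Tcases[OF t] show "\<exists>q\<in>Q t. adj t q \<and> (\<forall>u\<in>Q t. \<forall>v\<in>W - Q t. adj u v \<longrightarrow> u = q \<and> v = t)"
      proof
        assume tx: "t = x"
        have "u = c \<and> v = x" if "u \<in> C" "v \<in> W - C" "adj u v" for u v
        proof -
          have "v = x" using comps_closed[OF C(1) that(1,3)] that by auto
          then show ?thesis using uniq that by auto
        qed
        then show ?thesis using tx Qx c adj_sym by auto
      next
        assume "\<exists>H\<in>?I. t \<in> TT H"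
        then obtain H where H: "H \<in> ?I" "t \<in> TT H" by auto
        obtain q where q: "q \<in> Q t" "adj t q"
          "\<And>u v. u \<in> Q t \<Longrightarrow> v \<in> H \<Longrightarrow> v \<notin> Q t \<Longrightarrow> adj u v \<Longrightarrow> u = q \<and> v = t"
          by (rule cons_attachment[OF shape[OF H(1)] H(2)]) (rule that, blast+)
        have "u = q \<and> v = t" if uv: "u \<in> Q t" "v \<in> W - Q t" "adj u v" for u v
        proof -
          have "u \<in> H" using cons_shapeD(6)[OF shape[OF H(1)] H(2)] uv by auto
          moreover have "v \<noteq> x" using Qn[OF H] uv adj_sym by (auto simp: nbhd_def)
          ultimately have "v \<in> H" using comps_closed[OF comp(1)[OF H(1)] _ uv(3)] uv by auto
          then show ?thesis using q(3) uv by auto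
        qed
        then show ?thesis using q(1,2) by blast
      qed
    next
      fix s t assume st: "s \<in> T" "t \<in> T" "s \<noteq> t"
      have QK: "\<exists>K\<in>?I. y \<in> TT K \<and> Q y \<subseteq> K" if "y \<in> T" "y \<noteq> x" for y
        using Tcases[OF that(1)] that(2) cons_shapeD(6)[OF shape] by blast
      have CI: "C \<inter> K = {}" if "K \<in> ?I" for K using comp(2)[OF that] by (auto simp: R_def)
      show "Q s \<inter> Q t = {}"
      proof (cases "s = x \<or> t = x")
        case True
        then show ?thesis using st Qx QK CI by blast
      next
        case False
        then obtain K L where K: "K \<in> ?I" "s \<in> TT K" "Q s \<subseteq> K" and L: "L \<in> ?I" "t \<in> TT L" "Q t \<subseteq> L"
          using QK st by metis
        show ?thesis
        proof (cases "K = L")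
          case True
          then show ?thesis using cons_shapeD(7)[OF shape[OF K(1)] K(2)] L st by auto
        next
          case False
          then show ?thesis using comps_disjoint[OF K(1) L(1)] K L by auto
        qed
      qed
    qed
    \<comment> \<open>Upper bound: \<open>T\<close> isolates \<open>W\<close>, yet
      \<open>isolable 0 W\<close> fails. Lower bound: \<open>x\<close> and its copy account for five
      edges, and each component with its connecting edge for \<open>6 * card (TT H)\<close>.\<close>
    moreover have "card (inner W) + 1 = 6 * card T"
    proof (rule antisym)
      show "card (inner W) + 1 \<le> 6 * card T"
        using cons_isolates[OF \<open>cons_shape W T Q\<close>] no unfolding isolable_def
        by (metis Suc_eq_plus1 add.right_neutral not_less_eq_eq)
      have fI: "finite ?I" using fin finite_comps by auto
      have "card (inner R) + (\<Sum>H\<in>?I. card (inner H) + card (between H R)) \<le> card (inner W)"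
        using card_inner_family[OF fin fI R(1), of "\<lambda>H. H"] comp(2) comps_disjoint by blast
      moreover have "(\<Sum>H\<in>?I. 6 * card (TT H)) \<le> (\<Sum>H\<in>?I. card (inner H) + card (between H R))"
      proof (rule sum_mono)
        fix H assume "H \<in> ?I"
        then show "6 * card (TT H) \<le> card (inner H) + card (between H R)"
          using F(2)[of H] pos[of H] by (simp add: TT_def)
      qed
      moreover have "card T \<le> 1 + (\<Sum>H\<in>?I. card (TT H))"
        using card_Un_le[of "{x}" "\<Union>H\<in>?I. TT H"] card_UN_le[OF fI, of TT] by (simp add: T_def)
      moreover have "5 \<le> card (inner R)" using inR pos1 by linarith
      ultimately show "6 * card T \<le> card (inner W) + 1" by (simp add: sum_distrib_left[symmetric])
    qed
    ultimately show False using \<open>\<not> is_cons W\<close> by (auto simp: is_cons_def)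
  qed
qed

text \<open>All six edges come from \<open>H\<close>, as \<open>{x}\<close> has none: a diamond
  offers its five edges and a connecting one, a family member five plus a connecting one as soon as
  a copy is touched. The other components have deficit at most one, since pendant four-cycles are
  excluded, and pay it with a connecting edge.\<close>

lemma pendant_tight:
  assumes fin: "finite W" and conn: "conn W"
    and IH: "\<And>H. H \<subset> W \<Longrightarrow> conn H \<Longrightarrow> classified H"
    and no: "\<And>x C. x \<in> W \<Longrightarrow> C \<in> comps (W - {x}) \<Longrightarrow> \<not> is_C4 C"
    and x: "x \<in> W" and H: "H \<in> comps (W - {x})" "tight H"
  shows "isolable 0 W"
proof (rule isolable_by_removal[OF fin, of "{x}" x])
  have finH: "finite H" using comps_subset[OF H(1)] fin by (meson Diff_subset finite_subset)
  have pos: "1 \<le> card (between K {x})" if "K \<in> comps (W - {x})" for K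
    using between_pos[OF fin conn _ _ that] x by auto
  show "Z \<inter> {x} = {}" if "Z \<subseteq> W - nbhd {x}" for Z using that by (auto simp: nbhd_def)
  show "saves x {x} K 0" if K: "K \<in> comps (W - {x})" for K
  proof -
    have "classified K" using IH comps_psubset[OF K] comps_conn[OF K] x by auto
    then have "isolable 1 K"
      using no[OF x K] tight_isolable by (auto simp: classified_def isolable_def)
    then show ?thesis using isolable_saves[of 1 K 0 "{x}" x] pos[OF K] by auto
  qed
  have "saves x {x} H 6"
  proof (cases "is_diamond H")
    case True
    obtain y where "y \<in> H" "adj y x" using comp_attached[OF conn _ _ H(1)] x by auto
    then have "H \<inter> nbhd {x} \<noteq> {}" using adj_sym by (auto simp: nbhd_def)
    then show ?thesis
      using True pos[OF H(1)] spans_C4_card is_diamond_spans card_inner_diamond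
      by (intro four_saves) auto
  next
    case False
    then obtain T Q where TQ: "cons_shape H T Q" "card (inner H) + 1 = 6 * card T"
      using H by (auto simp: tight_def is_cons_def)
    obtain t where t: "t \<in> T" using cons_shapeD(1)[OF TQ(1)] by (auto simp: conn_def)
    \<comment> \<open>Any \<open>t\<close> will do: an untouched copy would be a pendant four-cycle
      at \<open>t\<close>.\<close>
    have "Q t \<inter> nbhd {x} \<noteq> {}"
    proof
      assume a: "Q t \<inter> nbhd {x} = {}"
      have "Q t \<in> comps (W - {t})"
        by (rule cons_copy_is_comp[OF TQ(1) t H(1)]) (use a adj_sym in \<open>auto simp: nbhd_def\<close>)
      moreover have "t \<in> W" using t cons_shapeD(2)[OF TQ(1)] comps_subset[OF H(1)] by auto
      ultimately show False using no cons_shapeD(4)[OF TQ(1) t] by blast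
    qed
    then show ?thesis using cons_saves[OF TQ t _ _ finH, of x 6] pos[OF H(1)] by auto
  qed
  then show "6 \<le> card (inner {x}) + 0 \<or> (\<exists>H\<in>comps (W - {x}). \<exists>s. saves x {x} H s \<and> 6 \<le> card (inner {x}) + s + 0)"
    using H(1) by (intro disjI2 bexI[of _ H] exI[of _ 6]) simp_all
qed (use x in auto)


end

subsection \<open>Graphs without pendant extremal pieces\<close>

text \<open>What is left of the induction step. A diamond satisfies these assumptions and therefore
  survives as an exception; a member of the family does not, since each of its copies is pendant at
  a tree vertex.\<close>

locale no_pendant_copy = edge_system E for E :: "'a set set" +
  fixes W :: "'a set"
  assumes fin: "finite W" and conn: "conn W"
    and IH: "H \<subset> W \<Longrightarrow> conn H \<Longrightarrow> classified H"
    and no_pendant: "x \<in> W \<Longrightarrow> H \<in> comps (W - {x}) \<Longrightarrow> \<not> is_C4 H \<and> \<not> tight H"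
    and not_C4: "\<not> is_C4 W"
    and has_C4: "has_C4 W"
begin

lemma finite_comp: "H \<in> comps (W - R) \<Longrightarrow> finite H"
  using finite_subset[OF comps_subset finite_Diff[OF fin]] .

lemma finite_between_comp: "H \<in> comps (W - R) \<Longrightarrow> R \<subseteq> W \<Longrightarrow> finite (between H R)"
  by (rule finite_between[OF finite_comp finite_subset[OF _ fin]])

text \<open>Were \<open>r\<close> the only neighbour of the component in \<open>R\<close>, the
  component would be pendant at \<open>r\<close>.\<close>

lemma second_attachment:
  assumes "H \<in> comps (W - R)" "R \<subseteq> W" "is_C4 H \<or> tight H" "r \<in> R"
  obtains h s where "h \<in> H" "s \<in> R" "s \<noteq> r" "adj h s"
proof (rule ccontr)
  assume "\<not> thesis"
  then have "H \<in> comps (W - {r})"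
    using that assms by (intro comp_of_smaller_removal[OF assms(1)]) auto
  then show False using no_pendant assms by blast
qed

lemma two_le_card: "finite S \<Longrightarrow> e \<in> S \<Longrightarrow> f \<in> S \<Longrightarrow> e \<noteq> f \<Longrightarrow> 2 \<le> card S"
  using card_mono[of S "{e, f}"] by simp

lemma between_ge_two:
  assumes "H \<in> comps (W - R)" "R \<subseteq> W" "R \<noteq> {}" "is_C4 H \<or> tight H"
  shows "2 \<le> card (between H R)"
proof -
  obtain h r where hr: "h \<in> H" "r \<in> R" "adj h r" using comp_attached[OF conn assms(2,3,1)] .
  obtain k s where ks: "k \<in> H" "s \<in> R" "s \<noteq> r" "adj k s"
    using second_attachment[OF assms(1,2,4) hr(2)] .
  have "H \<inter> R = {}" using comps_subset[OF assms(1)] by auto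
  then have "{h, r} \<noteq> {k, s}" using hr ks by (auto simp: doubleton_eq_iff)
  then show ?thesis
    using two_le_card[OF finite_between_comp[OF assms(1,2)]] hr ks edge_in_between by meson
qed

lemma comp_classified:
  assumes "H \<in> comps (W - R)" "R \<subseteq> W" "R \<noteq> {}"
  shows "classified H"
proof (rule IH)
  show "H \<subset> W" using comps_subset[OF assms(1)] assms(2,3) by blast
  show "conn H" using assms(1) by (rule comps_conn)
qed

text \<open>Without deficit one connecting edge is enough, with deficit one the two guaranteed edges
  are, but a four-cycle needs a third: with exactly two it has nothing to spare.\<close>

lemma comp_saves_one:
  assumes "H \<in> comps (W - R)" "R \<subseteq> W" "R \<noteq> {}"
  shows "saves x R H 1 \<or> is_C4 H \<and> card (between H R) = 2"
proof -
  have "classified H" using comp_classified assms by blast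
  then consider "is_C4 H" | "isolable 0 H" | "tight H" by (auto simp: classified_def)
  then show ?thesis
  proof cases
    case 1
    then have "2 \<le> card (between H R)" using between_ge_two assms by blast
    then show ?thesis using isolable_saves[OF is_C4_isolable[OF 1], of 1 R x] 1 by fastforce
  next
    case 2
    then show ?thesis using isolable_saves[OF 2, of 1 R x] between_pos[OF fin conn assms(2,3,1)] by simp
  next
    case 3
    then have "2 \<le> card (between H R)" using between_ge_two assms by blast
    then show ?thesis using isolable_saves[OF tight_isolable[OF 3], of 1 R x] by simp
  qed
qed

lemma comp_saves_zero:
  assumes "H \<in> comps (W - R)" "R \<subseteq> W" "R \<noteq> {}"
  shows "saves x R H 0"
  using comp_saves_one[OF assms, of x]
proof
  assume "saves x R H 1" then show ?thesis using saves_mono by blast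
next
  assume "is_C4 H \<and> card (between H R) = 2"
  then show ?thesis using isolable_saves[OF is_C4_isolable, of H 0 R x] by simp
qed

text \<open>The exceptional four-cycle ceases to be exceptional when \<open>nbhd {x}\<close> meets
  it, for then no vertex is spent on it.\<close>

lemma near_comp_saves_one:
  assumes "K \<in> comps (W - R)" "R \<subseteq> W" "R \<noteq> {}" "2 \<le> card (between K R)" "K \<inter> nbhd {x} \<noteq> {}"
  shows "saves x R K 1"
  using comp_saves_one[OF assms(1-3), of x]
proof
  assume "is_C4 K \<and> card (between K R) = 2"
  then show ?thesis
    using four_saves[OF spans_C4_card[OF is_C4_spans] assms(5), of 1 R] assms(4) by simp
qed

lemma isolable_by_comp_removal:
  assumes "R \<subseteq> W" "x \<in> R"
    and "\<And>Z. spans_C4 Z \<Longrightarrow> Z \<subseteq> W - nbhd {x} \<Longrightarrow> Z \<inter> R = {}"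
    and "6 \<le> card (inner R) \<or> (\<exists>H\<in>comps (W - R). \<exists>s. saves x R H s \<and> 6 \<le> card (inner R) + s)"
  shows "isolable 0 W"
proof (rule isolable_by_removal[OF fin assms(1-3)])
  show "saves x R H 0" if "H \<in> comps (W - R)" for H
    using comp_saves_zero[OF that assms(1)] assms(2) by blast
qed (use assms(4) in simp_all)

text \<open>An edge leaving a component inside \<open>W\<close> ends in \<open>R\<close>. Those in
  \<open>X\<close> are destroyed by the centre, and at most one other exists. This supplies the
  hypothesis of \<open>bridge_not_in_C4\<close>.\<close>

lemma few_crossings:
  assumes "H \<in> comps (W - R)" "R \<subseteq> W" "X \<subseteq> between H R" "\<And>e. e \<in> X \<Longrightarrow> e \<inter> nbhd {x} \<noteq> {}"
    and "card (between H R) \<le> card X + 1"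
  shows "card {e \<in> E. e \<subseteq> W - nbhd {x} \<and> e \<inter> H \<noteq> {} \<and> e - H \<noteq> {}} \<le> 1"
proof -
  have finB: "finite (between H R)" using finite_between_comp[OF assms(1,2)] .
  have "{e \<in> E. e \<subseteq> W - nbhd {x} \<and> e \<inter> H \<noteq> {} \<and> e - H \<noteq> {}} \<subseteq> between H R - X"
  proof
    fix e assume "e \<in> {e \<in> E. e \<subseteq> W - nbhd {x} \<and> e \<inter> H \<noteq> {} \<and> e - H \<noteq> {}}"
    then have e: "e \<in> E" "e \<subseteq> W - nbhd {x}" "e \<inter> H \<noteq> {}" "e - H \<noteq> {}" by auto
    then have "e \<notin> X" using assms(4) by auto
    obtain u v where uv: "e = {u, v}" "adj u v" using edge_cases[OF e(1)] by metis
    then have "u \<in> H \<and> v \<in> R \<or> v \<in> H \<and> u \<in> R"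
      using e comps_closed[OF assms(1), of u v] comps_closed[OF assms(1), of v u] adj_sym[of u v] by auto
    then show "e \<in> between H R - X" using e(1) \<open>e \<notin> X\<close> uv(1) by (auto simp: between_def)
  qed
  then have "card {e \<in> E. e \<subseteq> W - nbhd {x} \<and> e \<inter> H \<noteq> {} \<and> e - H \<noteq> {}} \<le> card (between H R - X)"
    using finB by (intro card_mono) auto
  also have "\<dots> \<le> 1" using assms(3,5) finB by (simp add: card_Diff_subset finite_subset)
  finally show ?thesis .
qed

lemma C4_in_W:
  obtains Z where "Z \<subseteq> W" "spans_C4 Z"
  using has_C4 unfolding has_C4_def by blast

text \<open>A four-cycle takes at least four of the five edges. A fifth edge leaving it would lead
  to a single further vertex at which the four-cycle is pendant, so the fifth edge is a
  chord.\<close>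

lemma five_edges_diamond:
  assumes "card (inner W) = 5"
  shows "is_diamond W"
proof -
  obtain Z where Z: "Z \<subseteq> W" "spans_C4 Z" by (rule C4_in_W)
  have 4: "4 \<le> card (inner Z)" using card_inner_spans_C4 Z by auto
  have "Z \<noteq> {}" using spans_C4_card[OF Z(2)] by auto
  then have le: "card (inner Z) + card (W - Z) \<le> 5"
    using card_inner_connected_ge[OF fin conn Z(1)] assms by simp
  from Z(2) consider "is_C4 Z" | "is_diamond Z" | "6 \<le> card (inner Z)" by (rule spans_C4_cases)
  then show ?thesis
  proof cases
    case 1
    then have "W \<noteq> Z" using not_C4 by auto
    then have "card (W - Z) > 0" using Z(1) fin by (auto simp: card_gt_0_iff)
    then have "card (W - Z) = 1" using le 4 by linarith
    then obtain y where y: "W - Z = {y}" by (metis card_1_singletonE)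
    then have "W - {y} = Z" "y \<in> W" using Z(1) by auto
    then have "Z \<in> comps (W - {y})" using spans_C4_conn[OF Z(2)] by (auto simp: comps_def)
    then show ?thesis using no_pendant[OF \<open>y \<in> W\<close>] 1 by auto
  next
    case 2
    then have "card (W - Z) = 0" using card_inner_diamond le by auto
    then have "W = Z" using Z(1) fin by auto
    then show ?thesis using 2 by simp
  next
    case 3 then show ?thesis using le by simp
  qed
qed

text \<open>If removing the closed neighbourhood of \<open>v\<close> fails, it spans exactly five
  edges and leaves a four-cycle \<open>H\<close> with two connecting edges, ending at distinct
  neighbours \<open>x\<close> and \<open>z\<close> of \<open>v\<close>. Exchange: remove
  \<open>insert x H\<close> around \<open>x\<close>. This spans five edges again, and the sixth is
  saved by the component of \<open>v\<close>: it also contains \<open>z\<close>, so it is joined to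
  \<open>x\<close> from \<open>v\<close> and to \<open>H\<close> from \<open>z\<close>, and
  \<open>nbhd {x}\<close> meets it in \<open>v\<close>.\<close>

lemma dense_star:
  assumes v: "v \<in> W" "5 \<le> card (inner (nbhd {v} \<inter> W))"
  shows "isolable 0 W \<or> is_diamond W"
proof (rule disjCI)
  assume nd: "\<not> is_diamond W"
  define R where "R = nbhd {v} \<inter> W"
  have R: "R \<subseteq> W" "v \<in> R" "R \<noteq> {}" using v by (auto simp: R_def nbhd_def)
  show "isolable 0 W"
  proof (rule ccontr)
    assume no: "\<not> isolable 0 W"
    have ng: "\<not> (6 \<le> card (inner R) \<or> (\<exists>H\<in>comps (W - R). \<exists>s. saves v R H s \<and> 6 \<le> card (inner R) + s))"
      using isolable_by_comp_removal[OF R(1,2)] no unfolding R_def by blast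
    then have five: "card (inner R) = 5" using v R_def by simp
    have "R \<noteq> W" using five five_edges_diamond nd by auto
    then obtain w where w: "w \<in> W - R" using R by auto
    then obtain H where H: "H \<in> comps (W - R)" using comps_cover[of "W - R" w] fin by auto
    have HC: "is_C4 H" "card (between H R) = 2"
      using comp_saves_one[OF H R(1,3), of v] ng five H by auto
    have HW: "H \<subseteq> W - R" using H by (rule comps_subset)
    have vH: "\<not> adj v h" if "h \<in> H" for h using HW that by (auto simp: R_def nbhd_def)
    obtain h x where hx: "h \<in> H" "x \<in> R" "adj h x" using comp_attached[OF conn R(1,3) H] .
    obtain k z where kz: "k \<in> H" "z \<in> R" "z \<noteq> x" "adj k z"
      using second_attachment[OF H R(1) _ hx(2)] HC by auto
    have xv: "x \<noteq> v" "z \<noteq> v" using hx kz vH adj_sym by auto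
    then have av: "adj v x" "adj v z" using hx kz by (auto simp: R_def nbhd_def)
    let ?R = "insert x H"
    have R': "?R \<subseteq> W" "x \<in> ?R" "?R \<noteq> {}" using HW hx R by auto
    have xH: "x \<notin> H" "z \<notin> H" "v \<notin> H" using HW hx kz R by auto
    have hn: "h \<in> nbhd {x}" using hx adj_sym by (auto simp: nbhd_def)
    have card4: "card H = 4" using HC spans_C4_card is_C4_spans by auto
    have "5 \<le> card (inner ?R)"
    proof -
      have "{x, h} \<in> between {x} H" using hx adj_sym by (intro edge_in_between) auto
      then have "1 \<le> card (between {x} H)"
        using finite_between[of "{x}" H] finite_comp[OF H]
        by (metis One_nat_def Suc_leI card_gt_0_iff empty_iff finite.emptyI finite.insertI)
      then show ?thesis
        using card_inner_Un[of "{x}" H] xH finite_comp[OF H] card_inner_is_C4[OF HC(1)] by simp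
    qed
    moreover obtain K where K: "K \<in> comps (W - ?R)" "v \<in> K"
      using comps_cover[of "W - ?R" v] fin v xH xv by auto
    have "z \<in> K" using comps_closed[OF K av(2)] kz xH R by auto
    have "saves x ?R K 1"
    proof (rule near_comp_saves_one[OF K(1) R'(1,3)])
      show "K \<inter> nbhd {x} \<noteq> {}" using K(2) av adj_sym by (auto simp: nbhd_def)
      have "{v, x} \<in> between K ?R" "{z, k} \<in> between K ?R"
        using K(2) \<open>z \<in> K\<close> av kz adj_sym by (auto intro!: edge_in_between)
      moreover have "{v, x} \<noteq> {z, k}" using kz xH by (auto simp: doubleton_eq_iff)
      ultimately show "2 \<le> card (between K ?R)"
        by (rule two_le_card[OF finite_between_comp[OF K(1) R'(1)]])
    qed
    moreover have "Z \<inter> ?R = {}" if Z: "spans_C4 Z" "Z \<subseteq> W - nbhd {x}" for Z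
    proof -
      have "Z \<inter> H = {}"
      proof (rule bridge_not_in_C4[OF fin finite_comp[OF H] _ _ Z])
        show "card (H - nbhd {x}) \<le> 3" using four_minus_nbhd(2)[OF card4] hn hx by auto
        show "card {e \<in> E. e \<subseteq> W - nbhd {x} \<and> e \<inter> H \<noteq> {} \<and> e - H \<noteq> {}} \<le> 1"
          by (rule few_crossings[OF H R(1), of "{{h, x}}"])
            (use hx HC hn in \<open>auto intro: edge_in_between\<close>)
      qed
      moreover have "x \<notin> Z" using Z by (auto simp: nbhd_def)
      ultimately show ?thesis by auto
    qed
    ultimately have "isolable 0 W"
      using K(1) by (intro isolable_by_comp_removal[OF R'(1,2)] disjI2 bexI[of _ K] exI[of _ 1]) auto
    then show False using no by simp
  qed
qed

text \<open>Here \<open>c\<close> isolates \<open>H\<close>, and the component containing \<open>a\<close>, \<open>b\<close>, \<open>d\<close> has two edges to \<open>c\<close>; if it is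
  extremal it has a third edge to \<open>H\<close>.\<close>

lemma square_outside:
  assumes H: "H \<subseteq> W" "c \<in> H" "4 \<le> card (inner H)"
    and out: "a \<in> W - H" "b \<in> W - H" "d \<in> W - H" "b \<noteq> d"
    and adj: "adj a b" "adj a d" "adj c b" "adj c d"
    and notouch: "\<And>Z. spans_C4 Z \<Longrightarrow> Z \<subseteq> W - nbhd {c} \<Longrightarrow> Z \<inter> H = {}"
  shows "isolable 0 W"
proof -
  have ne: "H \<noteq> {}" using H by auto
  obtain K where K: "K \<in> comps (W - H)" "a \<in> K" using comps_cover[of "W - H" a] fin out by auto
  have bd: "b \<in> K" "d \<in> K" using comps_closed[OF K adj(1)] comps_closed[OF K adj(2)] out by auto
  have KH: "K \<inter> H = {}" using comps_subset[OF K(1)] by auto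
  have e: "{b, c} \<in> between K H" "{d, c} \<in> between K H"
    using bd H adj adj_sym by (auto intro!: edge_in_between)
  have ne2: "{b, c} \<noteq> {d, c}" using out by (auto simp: doubleton_eq_iff)
  have finB: "finite (between K H)" using finite_between_comp[OF K(1) H(1)] .
  have two: "2 \<le> card (between K H)" using two_le_card[OF finB e ne2] .
  have "classified K" using comp_classified[OF K(1) H(1) ne] .
  then consider "is_C4 K" | "isolable 0 K" | "tight K" by (auto simp: classified_def)
  then have "saves c H K 2"
  proof cases
    case 1
    moreover have "K \<inter> nbhd {c} \<noteq> {}" using bd adj by (auto simp: nbhd_def)
    ultimately show ?thesis
      using four_saves[OF spans_C4_card[OF is_C4_spans], of K c 2 H] card_inner_is_C4 by simp
  next
    case 2
    then show ?thesis using isolable_saves[OF 2, of 2 H c] two by simp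
  next
    case 3
    obtain k s where ks: "k \<in> K" "s \<in> H" "s \<noteq> c" "adj k s"
      using second_attachment[OF K(1) H(1) _ H(2)] 3 by auto
    then have "{{k, s}, {b, c}, {d, c}} \<subseteq> between K H" using e edge_in_between by auto
    then have "card {{k, s}, {b, c}, {d, c}} \<le> card (between K H)" by (rule card_mono[OF finB])
    moreover have "{k, s} \<noteq> {b, c}" "{k, s} \<noteq> {d, c}" using ks H KH by (auto simp: doubleton_eq_iff)
    ultimately have "3 \<le> card (between K H)" using ne2 by simp
    then show ?thesis using isolable_saves[OF tight_isolable[OF 3], of 2 H c] by simp
  qed
  then show ?thesis
    using K(1) H(3) by (intro isolable_by_comp_removal[OF H(1,2) notouch] disjI2 bexI[of _ K] exI[of _ 2]) auto
qed

section \<open>Graphs whose closed neighbourhoods span at most four edges\<close>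

definition sparse :: bool where
  "sparse \<longleftrightarrow> (\<forall>v\<in>W. card (inner (nbhd {v} \<inter> W)) \<le> 4)"

text \<open>A chord at \<open>a\<close> puts the whole four-cycle and the chord into
  \<open>nbhd {a}\<close>, five edges in all. Hence every four-cycle is induced and diamonds do not
  occur.\<close>

lemma sparse_no_chord:
  assumes "sparse" "cycle4 a b c d" "{a, b, c, d} \<subseteq> W"
  shows "\<not> adj a c"
proof
  assume "adj a c"
  then have "{{a, b}, {b, c}, {c, d}, {d, a}, {a, c}} \<subseteq> inner (nbhd {a} \<inter> W)"
    using assms(2,3) adj_sym by (auto simp: inner_def nbhd_def cycle4_def adj_def)
  then have "card {{a, b}, {b, c}, {c, d}, {d, a}, {a, c}} \<le> card (inner (nbhd {a} \<inter> W))"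
    using fin by (intro card_mono finite_inner) auto
  moreover have "card {{a, b}, {b, c}, {c, d}, {d, a}, {a, c}} = 5"
    using assms(2) by (auto simp: cycle4_def doubleton_eq_iff)
  ultimately show False using assms(1,3) by (auto simp: sparse_def)
qed

lemma sparse_is_C4:
  assumes "sparse" "spans_C4 Z" "Z \<subseteq> W"
  shows "is_C4 Z"
proof -
  obtain a b c d where Z: "Z = {a, b, c, d}" "cycle4 a b c d"
    using assms by (auto simp: spans_C4_def)
  moreover have "\<not> adj a c" using sparse_no_chord[OF assms(1) Z(2)] Z assms(3) by auto
  moreover have "\<not> adj b d" using sparse_no_chord[OF assms(1) cycle4_rotate[OF Z(2)]] Z assms(3) by auto
  ultimately show ?thesis unfolding is_C4_def by blast
qed

lemma card_star_ge_degree: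
  assumes "a \<in> W"
  shows "card {u \<in> W. adj a u} \<le> card (inner (nbhd {a} \<inter> W))"
proof -
  have "inj_on (\<lambda>u. {a, u}) {u \<in> W. adj a u}" by (auto simp: inj_on_def doubleton_eq_iff)
  moreover have "(\<lambda>u. {a, u}) ` {u \<in> W. adj a u} \<subseteq> inner (nbhd {a} \<inter> W)"
    using assms by (auto simp: inner_def nbhd_def adj_def)
  ultimately show ?thesis using fin by (intro card_inj_on_le finite_inner) auto
qed

text \<open>The closed neighbourhood of \<open>a\<close> spans at least four edges, so two saved
  edges would suffice. The component \<open>H\<close> of the opposite vertex \<open>c\<close> has
  two connecting edges at \<open>c\<close> already; if it still saves fewer than two, it is a
  four-cycle with at most three connecting edges or a family member on five vertices. Either is
  small enough to be removed itself, around \<open>c\<close>, whose outside neighbours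
  \<open>b\<close> and \<open>d\<close> meet again in \<open>a\<close>.\<close>

lemma square_degree_four:
  assumes sparse and sq: "cycle4 a b c d" "{a, b, c, d} \<subseteq> W" and deg: "4 \<le> card {u \<in> W. adj a u}"
  shows "isolable 0 W"
proof (rule ccontr)
  assume no: "\<not> isolable 0 W"
  define R where "R = nbhd {a} \<inter> W"
  have R: "R \<subseteq> W" "a \<in> R" "R \<noteq> {}" using sq by (auto simp: R_def nbhd_def)
  have four: "4 \<le> card (inner R)" using deg card_star_ge_degree sq(2) unfolding R_def by fastforce
  have adj: "adj a b" "adj a d" "adj c b" "adj c d" and ne: "a \<noteq> c" "b \<noteq> d"
    using sq adj_sym by (auto simp: cycle4_def)
  have bR: "b \<in> R" "d \<in> R" using adj sq by (auto simp: R_def nbhd_def)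
  have "c \<in> W - R" using sparse_no_chord[OF assms(1) sq] ne sq(2) by (auto simp: R_def nbhd_def)
  then obtain H where H: "H \<in> comps (W - R)" "c \<in> H" using comps_cover[of "W - R" c] fin by auto
  have HW: "H \<subseteq> W - R" using H(1) by (rule comps_subset)
  have e: "{c, b} \<in> between H R" "{c, d} \<in> between H R"
    using H bR adj by (auto intro!: edge_in_between)
  have ne2: "{c, b} \<noteq> {c, d}" using ne by (auto simp: doubleton_eq_iff)
  have finB: "finite (between H R)" using finite_between_comp[OF H(1) R(1)] .
  have two: "2 \<le> card (between H R)" using two_le_card[OF finB e ne2] .
  have card2: "card {{c, b}, {c, d}} = 2" using ne2 by simp
  have ns: "\<not> saves a R H 2"
  proof
    assume "saves a R H 2"
    then have "isolable 0 W" using H(1) four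
      by (intro isolable_by_comp_removal[OF R(1,2)] disjI2 bexI[of _ H] exI[of _ 2]) (auto simp: R_def)
    then show False using no by simp
  qed
  have bc: "b \<in> nbhd {c}" "d \<in> nbhd {c}" using adj by (auto simp: nbhd_def)
  have "4 \<le> card (inner H) \<and> card (H - nbhd {c}) \<le> 3 \<and> card (between H R) \<le> 3"
  proof -
    have "classified H" using comp_classified[OF H(1) R(1,3)] .
    then consider "is_C4 H" | "isolable 0 H" | "tight H" by (auto simp: classified_def)
    then show ?thesis
    proof cases
      case 1
      have "card (H - nbhd {c}) \<le> 3"
      proof (rule four_minus_nbhd(2)[OF spans_C4_card[OF is_C4_spans[OF 1]]])
        show "H \<inter> nbhd {c} \<noteq> {}" using H(2) by (auto simp: nbhd_def)
      qed
      moreover have "card (between H R) \<le> 3"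
        using isolable_saves[OF is_C4_isolable[OF 1], of 2 R a] ns by fastforce
      ultimately show ?thesis using card_inner_is_C4[OF 1] by simp
    next
      case 2
      then show ?thesis using isolable_saves[OF 2, of 2 R a] ns two by simp
    next
      case 3
      have "\<not> is_diamond H"
      proof
        assume d: "is_diamond H"
        then have "is_C4 H" using sparse_is_C4[OF assms(1) is_diamond_spans] HW by auto
        then show False using card_inner_is_C4 card_inner_diamond[OF d] by simp
      qed
      then obtain T Q where TQ: "cons_shape H T Q" "card (inner H) + 1 = 6 * card T"
        using 3 by (auto simp: tight_def is_cons_def)
      \<comment> \<open>With deficit one, a third connecting edge would save two. So
        \<open>c\<close> is the only vertex of \<open>H\<close> joined to \<open>R\<close>, and a
        copy not containing \<open>c\<close> would be pendant at its tree vertex; as copies are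
        disjoint, there is only one.\<close>
      have two': "card (between H R) = 2"
        using isolable_saves[OF tight_isolable[OF 3], of 2 R a] ns two by fastforce
      have Beq: "{{c, b}, {c, d}} = between H R"
        by (rule card_subset_eq[OF finB]) (use e card2 two' in auto)
      have only: "u = c" if "u \<in> H" "r \<in> R" "adj u r" for u r
      proof -
        have "{u, r} \<in> {{c, b}, {c, d}}" unfolding Beq by (rule edge_in_between[OF that(3,1,2)])
        then have "u \<in> {c, b, d}" by blast
        then show ?thesis using that(1) HW bR by blast
      qed
      have cQ: "c \<in> Q t" if t: "t \<in> T" for t
      proof (rule ccontr)
        assume "c \<notin> Q t"
        then have "Q t \<in> comps (W - {t})"
          using only cons_shapeD(6)[OF TQ(1) t] by (intro cons_copy_is_comp[OF TQ(1) t H(1)]) blast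
        moreover have "t \<in> W" using cons_shapeD(2)[OF TQ(1)] t HW by auto
        ultimately show False using no_pendant cons_shapeD(4)[OF TQ(1) t] by blast
      qed
      obtain t where t: "t \<in> T" using cons_shapeD(1)[OF TQ(1)] by (auto simp: conn_def)
      have T: "T = {t}"
      proof -
        have "s = t" if "s \<in> T" for s
          using cons_shapeD(7)[OF TQ(1) that t] cQ[OF that] cQ[OF t] by blast
        then show ?thesis using t by blast
      qed
      then have Ht: "H = insert t (Q t)" using cons_shapeD(3)[OF TQ(1)] by simp
      obtain p q r where Q: "Q t = {c, p, q, r}" "cycle4 c p q r"
        using spans_C4_at[OF is_C4_spans[OF cons_shapeD(4)[OF TQ(1) t]] cQ[OF t]] .
      then have "H - nbhd {c} \<subseteq> {t, q}" using Ht adj_sym by (auto simp: nbhd_def cycle4_def)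
      then have "card (H - nbhd {c}) \<le> card {t, q}" by (intro card_mono) auto
      also have "\<dots> \<le> 2" by (simp add: card_insert_if)
      finally show ?thesis using TQ(2) T two' by simp
    qed
  qed
  then have p: "4 \<le> card (inner H)" "card (H - nbhd {c}) \<le> 3" "card (between H R) \<le> 3" by auto
  have "isolable 0 W"
  proof (rule square_outside[OF _ H(2) p(1) _ _ _ ne(2) adj])
    fix Z assume Z: "spans_C4 Z" "Z \<subseteq> W - nbhd {c}"
    show "Z \<inter> H = {}"
    proof (rule bridge_not_in_C4[OF fin finite_comp[OF H(1)] p(2) _ Z])
      \<comment> \<open>The edges from \<open>c\<close> to \<open>b\<close> and \<open>d\<close> are
        destroyed by the centre \<open>c\<close>; of at most three connecting edges one is
        left.\<close>
      show "card {e \<in> E. e \<subseteq> W - nbhd {c} \<and> e \<inter> H \<noteq> {} \<and> e - H \<noteq> {}} \<le> 1"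
        by (rule few_crossings[OF H(1) R(1), of "{{c, b}, {c, d}}"]) (use e card2 p bc in auto)
    qed
  qed (use HW R bR in auto)
  then show False using no by simp
qed

text \<open>Both neighbours of \<open>c\<close> on the square are dominated by \<open>a\<close>, so
  a surviving four-cycle through \<open>c\<close> would bring two more neighbours and degree
  four.\<close>

lemma opposite_not_in_C4:
  assumes sq: "cycle4 a b c d" "{a, b, c, d} \<subseteq> W" and deg: "card {u \<in> W. adj c u} \<le> 3"
    and Z: "spans_C4 Z" "Z \<subseteq> W - nbhd {a}"
  shows "c \<notin> Z"
proof
  assume "c \<in> Z"
  with Z(1) obtain p q where pq: "p \<in> Z" "q \<in> Z" "p \<noteq> q" "adj c p" "adj c q"
    by (rule spans_C4_two_neighbours)
  have bd: "b \<in> nbhd {a}" "d \<in> nbhd {a}" "b \<noteq> d" "adj c b" "adj c d"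
    using sq adj_sym by (auto simp: cycle4_def nbhd_def)
  then have "p \<noteq> b" "p \<noteq> d" "q \<noteq> b" "q \<noteq> d" using pq Z by auto
  then have "card {p, q, b, d} = 4" using pq bd by simp
  moreover have "card {p, q, b, d} \<le> card {u \<in> W. adj c u}"
    using pq bd sq(2) Z(2) fin by (intro card_mono) auto
  ultimately show False using deg by simp
qed

text \<open>Small degrees make a four-cycle \<open>Z\<close> safe to remove around any of its
  vertices, by the previous lemma. Together with an outside neighbour \<open>e\<close> it spans five
  edges, so failure makes every component a four-cycle with two connecting edges. One of these,
  \<open>H\<close>, is joined to a vertex \<open>p\<close> of \<open>Z\<close>; removing
  \<open>Z\<close> and \<open>H\<close> together around \<open>p\<close> yields four edges from
  each, more than the six required.\<close>

lemma squares_degree_three: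
  assumes sparse and deg: "\<And>Z z. spans_C4 Z \<Longrightarrow> Z \<subseteq> W \<Longrightarrow> z \<in> Z \<Longrightarrow> card {u \<in> W. adj z u} \<le> 3"
  shows "isolable 0 W"
proof (rule ccontr)
  assume no: "\<not> isolable 0 W"
  obtain Z where Z: "Z \<subseteq> W" "spans_C4 Z" by (rule C4_in_W)
  have C: "is_C4 Z" using sparse_is_C4[OF assms(1) Z(2,1)] .
  then have "Z \<noteq> W" using not_C4 by auto
  then obtain y where y: "y \<in> W" "y \<notin> Z" using Z(1) by auto
  obtain z where z: "z \<in> Z" using spans_C4_card[OF Z(2)] by fastforce
  obtain a e where ae: "a \<in> Z" "e \<in> W" "e \<notin> Z" "adj a e"
    by (rule conn_cut[OF conn _ z y]) (use z Z(1) that in auto)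
  obtain b c d where abcd: "Z = {a, b, c, d}" "cycle4 a b c d" using spans_C4_at[OF Z(2) ae(1)] .
  have finZ: "finite Z" using spans_C4_finite[OF Z(2)] .
  have notouch: "X \<inter> Z = {}"
    if p: "p \<in> Z" and X: "spans_C4 X" "X \<subseteq> W - nbhd {p}" for X p
  proof -
    obtain q r s where Zp: "Z = {p, q, r, s}" "cycle4 p q r s" using spans_C4_at[OF Z(2) p] .
    then have "r \<notin> X" using opposite_not_in_C4[OF Zp(2) _ _ X] deg[OF Z(2,1)] Z(1) by auto
    moreover have "p \<in> nbhd {p}" "q \<in> nbhd {p}" "s \<in> nbhd {p}"
      using Zp(2) adj_sym by (auto simp: nbhd_def cycle4_def)
    ultimately show ?thesis using Zp(1) X(2) by auto
  qed
  define R where "R = insert e Z"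
  have R: "R \<subseteq> W" "a \<in> R" "R \<noteq> {}" using Z ae by (auto simp: R_def)
  have five: "5 \<le> card (inner R)"
  proof -
    have "{e, a} \<in> between {e} Z" using ae adj_sym by (intro edge_in_between) auto
    then have "1 \<le> card (between {e} Z)"
      using finite_between[of "{e}" Z] finZ
      by (metis One_nat_def Suc_leI card_gt_0_iff empty_iff finite.emptyI finite.insertI)
    then show ?thesis
      using card_inner_Un[of "{e}" Z] ae finZ card_inner_is_C4[OF C] by (simp add: R_def)
  qed
  have notouchR: "X \<inter> R = {}" if "spans_C4 X" "X \<subseteq> W - nbhd {a}" for X
    using notouch[OF ae(1) that] ae that by (auto simp: R_def nbhd_def)
  have HC: "is_C4 H" "card (between H R) = 2" if H: "H \<in> comps (W - R)" for H
  proof -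
    have "\<not> saves a R H 1"
    proof
      assume "saves a R H 1"
      then have "isolable 0 W" using H five
        by (intro isolable_by_comp_removal[OF R(1,2) notouchR] disjI2 bexI[of _ H] exI[of _ 1]) auto
      then show False using no by simp
    qed
    then show "is_C4 H" "card (between H R) = 2" using comp_saves_one[OF H R(1,3), of a] by auto
  qed
  \<comment> \<open>Otherwise \<open>e\<close> alone would separate \<open>Z\<close> from the rest,
    and \<open>Z\<close> would be pendant at \<open>e\<close>.\<close>
  have "\<exists>H\<in>comps (W - R). \<exists>h\<in>H. \<exists>p\<in>Z. adj h p"
  proof (rule ccontr)
    assume none: "\<not> ?thesis"
    have "\<not> adj u v" if "u \<in> Z" "v \<in> W - {e} - Z" for u v
    proof
      assume "adj u v"
      have "v \<in> W - R" using that by (auto simp: R_def)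
      then obtain H where "H \<in> comps (W - R)" "v \<in> H" using comps_cover[of "W - R" v] fin by auto
      then show False using none that \<open>adj u v\<close> adj_sym by blast
    qed
    then have "Z \<in> comps (W - {e})"
      using spans_C4_conn[OF Z(2)] Z(1) ae by (auto simp: comps_def)
    then show False using no_pendant[OF ae(2)] C by auto
  qed
  then obtain H h p where H: "H \<in> comps (W - R)" and hp: "h \<in> H" "p \<in> Z" "adj h p" by auto
  have HW: "H \<subseteq> W - R" using H by (rule comps_subset)
  have hn: "h \<in> nbhd {p}" using hp adj_sym by (auto simp: nbhd_def)
  have "Z \<inter> H = {}" using HW by (auto simp: R_def)
  then have "6 \<le> card (inner (Z \<union> H))"
    using card_inner_Un[OF finZ finite_comp[OF H]] card_inner_is_C4[OF C]
      card_inner_is_C4[OF HC(1)[OF H]] by simp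
  moreover have "X \<inter> (Z \<union> H) = {}" if X: "spans_C4 X" "X \<subseteq> W - nbhd {p}" for X
  proof -
    have "X \<inter> H = {}"
    proof (rule bridge_not_in_C4[OF fin finite_comp[OF H] _ _ X])
      show "card (H - nbhd {p}) \<le> 3"
        using four_minus_nbhd(2)[OF spans_C4_card[OF is_C4_spans[OF HC(1)[OF H]]]] hn hp by auto
      have "{h, p} \<in> between H R" using hp by (intro edge_in_between) (auto simp: R_def)
      then show "card {e \<in> E. e \<subseteq> W - nbhd {p} \<and> e \<inter> H \<noteq> {} \<and> e - H \<noteq> {}} \<le> 1"
        using HC(2)[OF H] hn by (intro few_crossings[OF H R(1), of "{{h, p}}"]) auto
    qed
    then show ?thesis using notouch[OF hp(2) X] by auto
  qed
  ultimately have "isolable 0 W"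
    using HW Z(1) hp(2) by (intro isolable_by_comp_removal[of "Z \<union> H" p]) auto
  then show False using no by simp
qed

lemma isolable_or_diamond: "isolable 0 W \<or> is_diamond W"
proof (cases sparse)
  case False
  then obtain v where "v \<in> W" "5 \<le> card (inner (nbhd {v} \<inter> W))" by (fastforce simp: sparse_def)
  then show ?thesis by (rule dense_star)
next
  case True
  show ?thesis
  proof (cases "\<exists>Z z. spans_C4 Z \<and> Z \<subseteq> W \<and> z \<in> Z \<and> 4 \<le> card {u \<in> W. adj z u}")
    case True
    then obtain Z z where Z: "spans_C4 Z" "Z \<subseteq> W" "z \<in> Z" "4 \<le> card {u \<in> W. adj z u}" by blast
    obtain b c d where "Z = {z, b, c, d}" "cycle4 z b c d" using spans_C4_at[OF Z(1,3)] .
    then show ?thesis using square_degree_four[OF \<open>sparse\<close>] Z by auto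
  next
    case False
    have "card {u \<in> W. adj z u} \<le> 3" if "spans_C4 Z" "Z \<subseteq> W" "z \<in> Z" for Z z
    proof (rule ccontr)
      assume "\<not> card {u \<in> W. adj z u} \<le> 3"
      then have "4 \<le> card {u \<in> W. adj z u}" by simp
      then show False using False that by blast
    qed
    then show ?thesis using squares_degree_three[OF \<open>sparse\<close>] by blast
  qed
qed

end

section \<open>The induction over connected vertex sets\<close>

context edge_system begin

theorem connected_classified:
  assumes "finite W" "conn W"
  shows "classified W"
  using assms
proof (induction W rule: finite_psubset_induct)
  case (psubset W)
  have IH: "classified H" if "H \<subset> W" "conn H" for H
    using psubset.IH[OF that(1)] that(2) .
  show ?case
  proof (rule ccontr)
    assume no: "\<not> classified W"
    then have n: "\<not> is_C4 W" "\<not> isolable 0 W" "\<not> tight W" unfolding classified_def by blast+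
    have nC: "\<not> is_C4 C" if "x \<in> W" "C \<in> comps (W - {x})" for x C
      using pendant_C4[OF psubset.hyps psubset.prems _ that] IH n unfolding tight_def by blast
    \<comment> \<open>Four-cycles come first because \<open>pendant_tight\<close> relies on their
      absence.\<close>
    have nt: "\<not> tight C" if "x \<in> W" "C \<in> comps (W - {x})" for x C
      using pendant_tight[OF psubset.hyps psubset.prems _ _ that] IH nC n(2) by blast
    have hC: "has_C4 W"
    proof (rule ccontr)
      assume "\<not> has_C4 W"
      then have "isolates {} W" by (simp add: isolates_def nbhd_def)
      then show False using n(2) unfolding isolable_def by (metis card.empty le0 mult_0_right)
    qed
    interpret no_pendant_copy E W
    proof
      show "finite W" "conn W" using psubset by blast+
      show "classified H" if "H \<subset> W" "conn H" for H using IH that .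
      show "\<not> is_C4 H \<and> \<not> tight H" if "x \<in> W" "H \<in> comps (W - {x})" for x H using nC nt that by blast
    qed (fact n hC)+
    show False using isolable_or_diamond n by (auto simp: tight_def)
  qed
qed

end

subsection \<open>Graphs, trees and isomorphisms\<close>

text \<open>\<open>isomorphic G H\<close> asks for a map out of \<open>G\<close>, whereas the
  natural witnesses below are labellings of \<open>G\<close> by the vertices of a concrete graph
  \<open>H\<close>; they are inverted here once and for all.\<close>

lemma isomorphic_sym_witness:
  assumes "bij_betw g (verts H) (verts G)"
    and "\<And>x y. x \<in> verts H \<Longrightarrow> y \<in> verts H \<Longrightarrow> {g x, g y} \<in> edges G \<longleftrightarrow> {x, y} \<in> edges H"
  shows "isomorphic G H"
  unfolding isomorphic_def
proof (intro exI conjI ballI)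
  let ?f = "inv_into (verts H) g"
  show "bij_betw ?f (verts G) (verts H)" using assms(1) by (rule bij_betw_inv_into)
  fix u v assume uv: "u \<in> verts G" "v \<in> verts G"
  then have "?f u \<in> verts H" "?f v \<in> verts H" "g (?f u) = u" "g (?f v) = v"
    using assms(1) by (auto simp: bij_betw_def inv_into_into f_inv_into_f)
  then show "{u, v} \<in> edges G \<longleftrightarrow> {?f u, ?f v} \<in> edges H" using assms(2)[of "?f u" "?f v"] by simp
qed

text \<open>The image of \<open>H\<close>, taken with the images of its edges only, is the required
  subgraph. So \<open>g\<close> has to preserve edges but may create new adjacencies in
  \<open>G\<close>.\<close>

lemma contains_copyI:
  assumes H: "simple_graph H" and g: "inj_on g (verts H)" "g ` verts H \<subseteq> verts G"
    and e: "\<And>e. e \<in> edges H \<Longrightarrow> g ` e \<in> edges G"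
  shows "contains_copy G H"
  unfolding contains_copy_def
proof (intro exI conjI)
  let ?S = "\<lparr>verts = g ` verts H, edges = (\<lambda>e. g ` e) ` edges H\<rparr>"
  have sub: "e \<subseteq> verts H" "card e = 2" if "e \<in> edges H" for e
    using that H by (auto simp: simple_graph_def)
  show "subgraph ?S G"
    unfolding subgraph_def
  proof (intro conjI)
    have "card (g ` e) = 2" if "e \<in> edges H" for e
      using sub[OF that] card_image[of g e] inj_on_subset[OF g(1)] by metis
    then show "simple_graph ?S" using H sub by (auto simp: simple_graph_def)
  qed (use g e in auto)
  show "isomorphic ?S H"
  proof (rule isomorphic_sym_witness[of g])
    show "bij_betw g (verts H) (verts ?S)" using g by (simp add: bij_betw_def)
    fix x y assume xy: "x \<in> verts H" "y \<in> verts H"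
    have "g ` {x, y} = g ` e \<longleftrightarrow> {x, y} = e" if "e \<in> edges H" for e
      by (rule inj_on_image_eq_iff[OF g(1)]) (use sub that xy in auto)
    then show "{g x, g y} \<in> edges ?S \<longleftrightarrow> {x, y} \<in> edges H" by (auto simp: image_iff)
  qed
qed

lemma contains_copyE:
  assumes "contains_copy G H" "simple_graph H"
  obtains g where "inj_on g (verts H)" "g ` verts H \<subseteq> verts G"
    "\<And>e. e \<in> edges H \<Longrightarrow> g ` e \<in> edges G"
proof -
  obtain S where S: "subgraph S G" "isomorphic S H" using assms by (auto simp: contains_copy_def)
  obtain f where f: "bij_betw f (verts S) (verts H)"
    "\<And>u v. u \<in> verts S \<Longrightarrow> v \<in> verts S \<Longrightarrow> {u, v} \<in> edges S \<longleftrightarrow> {f u, f v} \<in> edges H"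
    using S(2) by (auto simp: isomorphic_def)
  let ?g = "inv_into (verts S) f"
  have bij: "bij_betw ?g (verts H) (verts S)" using f(1) by (rule bij_betw_inv_into)
  show thesis
  proof (rule that[of ?g])
    show "inj_on ?g (verts H)" using bij by (simp add: bij_betw_def)
    show "?g ` verts H \<subseteq> verts G" using bij S(1) by (auto simp: bij_betw_def subgraph_def)
    fix e assume e: "e \<in> edges H"
    then have "card e = 2" "e \<subseteq> verts H" using assms(2) by (auto simp: simple_graph_def)
    then obtain x y where xy: "e = {x, y}" "x \<in> verts H" "y \<in> verts H" by (auto simp: card_2_iff)
    have "?g x \<in> verts S" "?g y \<in> verts S" "f (?g x) = x" "f (?g y) = y"
      using f(1) xy by (auto simp: bij_betw_def inv_into_into f_inv_into_f)
    then have "{?g x, ?g y} \<in> edges S" using f(2)[of "?g x" "?g y"] e xy by simp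
    then show "?g ` e \<in> edges G" using S(1) xy by (auto simp: subgraph_def)
  qed
qed

lemma card_edges_isomorphic_le:
  assumes "simple_graph G" "isomorphic G H" "finite (edges H)"
  shows "card (edges G) \<le> card (edges H)"
proof -
  obtain f where f: "bij_betw f (verts G) (verts H)"
    "\<And>u v. u \<in> verts G \<Longrightarrow> v \<in> verts G \<Longrightarrow> {u, v} \<in> edges G \<longleftrightarrow> {f u, f v} \<in> edges H"
    using assms(2) by (auto simp: isomorphic_def)
  have sub: "e \<subseteq> verts G" "card e = 2" if "e \<in> edges G" for e
    using that assms(1) by (auto simp: simple_graph_def)
  show ?thesis
  proof (rule card_inj_on_le[OF _ _ assms(3)])
    show "inj_on (\<lambda>e. f ` e) (edges G)"
      using sub f(1) by (auto simp: inj_on_def bij_betw_def inj_on_image_eq_iff)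
    show "(\<lambda>e. f ` e) ` edges G \<subseteq> edges H"
    proof
      fix d assume "d \<in> (\<lambda>e. f ` e) ` edges G"
      then obtain e where e: "e \<in> edges G" "d = f ` e" by auto
      then obtain u v where "e = {u, v}" using sub[OF e(1)] by (auto simp: card_2_iff)
      then show "d \<in> edges H" using e f(2)[of u v] sub[OF e(1)] by auto
    qed
  qed
qed

lemma simple_cycle_graph: "3 \<le> k \<Longrightarrow> simple_graph (cycle_graph k)"
proof -
  assume k: "3 \<le> k"
  have "i \<noteq> Suc i mod k" if "i < k" for i
    using that k by (cases "Suc i = k") auto
  then show ?thesis using k by (auto simp: simple_graph_def cycle_graph_def card_insert_if)
qed

lemma card_edges_cycle_graph:
  assumes "3 \<le> k"
  shows "card (edges (cycle_graph k)) = k"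
proof -
  have "inj_on (\<lambda>i. {i, Suc i mod k}) {..<k}"
  proof (rule inj_onI)
    fix i j assume ij: "i \<in> {..<k}" "j \<in> {..<k}" "{i, Suc i mod k} = {j, Suc j mod k}"
    show "i = j"
    proof (rule ccontr)
      assume "i \<noteq> j"
      \<comment> \<open>Equal edges with different starting points would make each of
        \<open>i\<close> and \<open>j\<close> the successor of the other, which a length of at least
        three forbids.\<close>
      then have "i = Suc j mod k" "j = Suc i mod k" using ij(3) by (auto simp: doubleton_eq_iff)
      moreover have "Suc i mod k = Suc i \<or> Suc i = k \<and> Suc i mod k = 0"
        "Suc j mod k = Suc j \<or> Suc j = k \<and> Suc j mod k = 0" using ij(1,2) by (auto simp: mod_Suc)
      ultimately show False using assms by arith
    qed
  qed
  moreover have "edges (cycle_graph k) = (\<lambda>i. {i, Suc i mod k}) ` {..<k}"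
    by (auto simp: cycle_graph_def)
  ultimately show ?thesis by (simp add: card_image)
qed

lemma lessThan_4: "{..<4 :: nat} = {0, 1, 2, 3}"
  by auto

lemma edges_cycle_graph_4: "edges (cycle_graph 4) = {{0, 1}, {1, 2}, {2, 3}, {3, 0}}"
proof -
  have "edges (cycle_graph 4) = (\<lambda>i. {i, Suc i mod 4}) ` {..<4}"
    by (auto simp: cycle_graph_def)
  moreover have "Suc 0 mod 4 = 1" "Suc 1 mod 4 = 2" "Suc 2 mod 4 = 3" "Suc 3 mod 4 = (0 :: nat)"
    by simp_all
  ultimately show ?thesis by (simp only: lessThan_4 image_insert image_empty)
qed

lemma verts_cycle_graph [simp]: "verts (cycle_graph k) = {..<k}"
  by (simp add: cycle_graph_def)

lemma verts_diamond: "verts diamond = {..<4}"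
  by (simp add: diamond_def complete_graph_def)

lemma edge_diamond:
  assumes "i < 4" "j < 4"
  shows "{i, j} \<in> edges diamond \<longleftrightarrow> i \<noteq> j \<and> {i, j} \<noteq> {0, 1}"
proof -
  have "{i, j} \<in> edges (complete_graph 4) \<longleftrightarrow> i \<noteq> j"
    using assms unfolding complete_graph_def by (auto simp: doubleton_eq_iff)
  then show ?thesis by (simp add: diamond_def)
qed

lemma edges_diamond: "edges diamond = {{0, 2}, {2, 1}, {1, 3}, {3, 0}, {2, 3}}"
proof (intro equalityI subsetI)
  fix e assume e: "e \<in> edges diamond"
  then obtain i j where ij: "e = {i, j}" "i < 4" "j < 4" by (auto simp: diamond_def complete_graph_def)
  then have "i \<in> {0, 1, 2, 3}" "j \<in> {0, 1, 2, 3}" "i \<noteq> j" "{i, j} \<noteq> {0, 1}"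
    using e edge_diamond by (auto simp flip: lessThan_4)
  then show "e \<in> {{0, 2}, {2, 1}, {1, 3}, {3, 0}, {2, 3}}" unfolding ij(1) by (auto simp: insert_commute)
next
  fix e assume "e \<in> {{0, 2}, {2, 1}, {1, 3}, {3, 0}, {2, 3 :: nat}}"
  then show "e \<in> edges diamond"
    using edge_diamond[of 0 2] edge_diamond[of 2 1] edge_diamond[of 1 3] edge_diamond[of 3 0]
      edge_diamond[of 2 3] by (auto simp: doubleton_eq_iff)
qed

lemma edge_cons_graph [simp]:
  "{Inl u, Inl v} \<in> edges (cons_graph T k) \<longleftrightarrow> {u, v} \<in> edges T"
  "{Inl u, Inr (v, i)} \<in> edges (cons_graph T k) \<longleftrightarrow> u = v \<and> i = 0 \<and> v \<in> verts T"
  "{Inr (v, i), Inl u} \<in> edges (cons_graph T k) \<longleftrightarrow> u = v \<and> i = 0 \<and> v \<in> verts T"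
  "{Inr (u, i), Inr (v, j)} \<in> edges (cons_graph T k) \<longleftrightarrow>
     u = v \<and> u \<in> verts T \<and> {i, j} \<in> edges (cycle_graph k)"
proof -
  have 1: "{Inl u, Inl v} = {Inl x, Inl y} \<longleftrightarrow> {u, v} = {x, y}" for u v x y :: 'a
    by (simp add: doubleton_eq_iff)
  have 2: "{Inr (u, i), Inr (v, j)} = {Inr (x, k), Inr (x, l)} \<longleftrightarrow> u = x \<and> v = x \<and> {i, j} = {k, l}"
    for u v x :: 'a and i j k l :: nat
    by (auto simp: doubleton_eq_iff)
  have 3: "{Inl u, Inl v} \<noteq> {Inl x, Inr y}" "{Inl u, Inl v} \<noteq> {Inr z, Inr y}"
    "{Inr z, Inr y} \<noteq> {Inl u, Inl v}" "{Inr z, Inr y} \<noteq> {Inl u, Inr w}"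
    "{Inl u, Inr y} \<noteq> {Inl x, Inl v}" "{Inl u, Inr y} \<noteq> {Inr z, Inr w}"
    for u v x :: 'a and y z w :: "'a \<times> nat"
    by (auto simp: doubleton_eq_iff)
  have 4: "{Inl u, Inr y} = {Inl x, Inr z} \<longleftrightarrow> u = x \<and> y = z" for u x :: 'a and y z :: "'a \<times> nat"
    by (simp add: doubleton_eq_iff)
  show "{Inl u, Inl v} \<in> edges (cons_graph T k) \<longleftrightarrow> {u, v} \<in> edges T"
    unfolding cons_graph_def by (simp add: 1 3) metis
  show "{Inr (u, i), Inr (v, j)} \<in> edges (cons_graph T k) \<longleftrightarrow>
     u = v \<and> u \<in> verts T \<and> {i, j} \<in> edges (cycle_graph k)"
    unfolding cons_graph_def by (simp add: 2 3) metis
  show 5: "{Inl u, Inr (v, i)} \<in> edges (cons_graph T k) \<longleftrightarrow> u = v \<and> i = 0 \<and> v \<in> verts T"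
    unfolding cons_graph_def by (simp add: 3 4) metis
  show "{Inr (v, i), Inl u} \<in> edges (cons_graph T k) \<longleftrightarrow> u = v \<and> i = 0 \<and> v \<in> verts T"
    using 5 by (simp add: insert_commute)
qed

lemma bij_betw_nth_four:
  assumes "distinct [a, b, c, d]"
  shows "bij_betw (nth [a, b, c, d]) {..<4} {a, b, c, d}"
proof -
  have "bij_betw (nth [a, b, c, d]) {..<length [a, b, c, d]} (set [a, b, c, d])"
    by (rule bij_betw_nth) (use assms in auto)
  then show ?thesis by (simp add: numeral_eq_Suc)
qed

section \<open>Cycles forced by degrees and edge counts\<close>

context edge_system begin

text \<open>All neighbours of the first vertex of a longest path lie on the path. Of two distinct
  ones, one has index at least two, and the edge to it closes a cycle.\<close>

lemma cycle_if_degrees_ge_two: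
  assumes fin: "finite W" and "W \<noteq> {}"
    and deg: "\<And>v. v \<in> W \<Longrightarrow> \<exists>p\<in>W. \<exists>q\<in>W. p \<noteq> q \<and> adj v p \<and> adj v q"
  shows "\<exists>k\<ge>3. contains_copy \<lparr>verts = W, edges = inner W\<rparr> (cycle_graph k)"
proof -
  let ?P = "\<lambda>xs. xs \<noteq> [] \<and> distinct xs \<and> set xs \<subseteq> W \<and>
    (\<forall>i. Suc i < length xs \<longrightarrow> adj (xs ! i) (xs ! Suc i))"
  obtain w where "w \<in> W" using assms(2) by auto
  then have 1: "?P [w]" by auto
  have "\<forall>xs. ?P xs \<longrightarrow> length xs < Suc (card W)"
  proof (intro allI impI)
    fix xs assume "?P xs"
    then show "length xs < Suc (card W)"
      using card_mono[OF fin, of "set xs"] distinct_card[of xs] by simp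
  qed
  from ex_has_greatest_nat[of ?P, OF 1 this]
  obtain xs where xs: "?P xs" "\<And>ys. ?P ys \<Longrightarrow> length ys \<le> length xs" by blast
  let ?x = "xs ! 0"
  have x: "?x \<in> W" using xs(1) by auto
  have nb: "p \<in> set xs" if "p \<in> W" "adj ?x p" for p
  proof (rule ccontr)
    assume "p \<notin> set xs"
    moreover have "adj ((p # xs) ! i) ((p # xs) ! Suc i)" if "Suc i < length (p # xs)" for i
      using that xs(1) \<open>adj ?x p\<close> adj_sym by (cases i) auto
    ultimately have "?P (p # xs)" using xs(1) that by auto
    then show False using xs(2)[of "p # xs"] by simp
  qed
  obtain p q where pq: "p \<in> W" "q \<in> W" "p \<noteq> q" "adj ?x p" "adj ?x q" using deg[OF x] by blast
  obtain i where i: "i < length xs" "xs ! i = p" using nb pq by (metis in_set_conv_nth)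
  obtain j where j: "j < length xs" "xs ! j = q" using nb pq by (metis in_set_conv_nth)
  have "i \<noteq> 0" "j \<noteq> 0" "i \<noteq> j" using i j pq by (metis not_adj_self)+
  then have "2 \<le> i \<or> 2 \<le> j" by linarith
  then obtain l where l: "2 \<le> l" "l < length xs" "adj ?x (xs ! l)" using i j pq by blast
  have "contains_copy \<lparr>verts = W, edges = inner W\<rparr> (cycle_graph (Suc l))"
  proof (rule contains_copyI[of _ "nth xs"])
    show "simple_graph (cycle_graph (Suc l))" using l by (intro simple_cycle_graph) auto
    show "inj_on ((!) xs) (verts (cycle_graph (Suc l)))"
      using xs(1) l by (auto simp: inj_on_def nth_eq_iff_index_eq)
    show "(!) xs ` verts (cycle_graph (Suc l)) \<subseteq> verts \<lparr>verts = W, edges = inner W\<rparr>"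
      using xs(1) l by auto
    fix e assume "e \<in> edges (cycle_graph (Suc l))"
    then obtain i where i: "i < Suc l" "e = {i, Suc i mod Suc l}" by (auto simp: cycle_graph_def)
    have "adj (xs ! i) (xs ! (Suc i mod Suc l))"
    proof (cases "i = l")
      case True then show ?thesis using l(3) adj_sym by simp
    next
      case False then show ?thesis using i xs(1) l(2) by auto
    qed
    moreover have "xs ! i \<in> W" "xs ! (Suc i mod Suc l) \<in> W"
    proof -
      have "Suc i mod Suc l < Suc l" by simp
      then have "Suc i mod Suc l < length xs" "i < length xs" using i l by linarith+
      then show "xs ! i \<in> W" "xs ! (Suc i mod Suc l) \<in> W" using xs(1) by (meson nth_mem subsetD)+
    qed
    ultimately show "(!) xs ` e \<in> edges \<lparr>verts = W, edges = inner W\<rparr>"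
      using i by (simp add: inner_def adj_def)
  qed
  then show ?thesis using l by (intro exI[of _ "Suc l"]) auto
qed

text \<open>Deleting a vertex with at most one neighbour loses one vertex and at most one edge, so
  the inequality persists until all degrees are at least two.\<close>

lemma cycle_if_many_edges:
  assumes "finite W" "W \<noteq> {}" "card W \<le> card (inner W)"
  shows "\<exists>k\<ge>3. contains_copy \<lparr>verts = W, edges = inner W\<rparr> (cycle_graph k)"
  using assms
proof (induction "card W" arbitrary: W)
  case 0 then show ?case by simp
next
  case (Suc n)
  show ?case
  proof (cases "\<forall>v\<in>W. \<exists>p\<in>W. \<exists>q\<in>W. p \<noteq> q \<and> adj v p \<and> adj v q")
    case True
    then show ?thesis using cycle_if_degrees_ge_two Suc.prems by blast
  next
    case False
    then obtain v where v: "v \<in> W" "\<And>p q. p \<in> W \<Longrightarrow> q \<in> W \<Longrightarrow> adj v p \<Longrightarrow> adj v q \<Longrightarrow> p = q" by blast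
    let ?U = "W - {v}"
    have "inner W \<subseteq> inner ?U \<union> {e \<in> inner W. v \<in> e}" by (auto simp: inner_def)
    then have "card (inner W) \<le> card (inner ?U \<union> {e \<in> inner W. v \<in> e})"
      using Suc.prems(1) finite_inner[of W] finite_inner[of ?U] by (intro card_mono) auto
    also have "\<dots> \<le> card (inner ?U) + card {e \<in> inner W. v \<in> e}" by (rule card_Un_le)
    finally have le: "card (inner W) \<le> card (inner ?U) + card {e \<in> inner W. v \<in> e}" .
    have "e = f" if ef: "e \<in> {e \<in> inner W. v \<in> e}" "f \<in> {e \<in> inner W. v \<in> e}" for e f
    proof -
      have form: "\<exists>p\<in>W. d = {v, p} \<and> adj v p" if d: "d \<in> {e \<in> inner W. v \<in> e}" for d
      proof -
        have "d \<in> E" using d by (auto simp: inner_def)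
        then obtain a b where "d = {a, b}" "adj a b" by (metis edge_cases)
        then show ?thesis using d adj_sym by (auto simp: inner_def insert_commute)
      qed
      show ?thesis using form[OF ef(1)] form[OF ef(2)] v(2) by blast
    qed
    then have "card {e \<in> inner W. v \<in> e} \<le> 1"
      using Suc.prems(1) finite_inner[of W] by (subst card_le_Suc0_iff_eq[folded One_nat_def]) auto
    then have le1: "card (inner W) \<le> card (inner ?U) + 1" using le by linarith
    have cU: "card W = Suc (card ?U)" using v(1) Suc.prems(1) by (metis card_Suc_Diff1)
    have "?U \<noteq> {}"
    proof
      assume U: "?U = {}"
      then have W: "W = {v}" using v(1) by auto
      have "e \<notin> inner W" for e
      proof
        assume "e \<in> inner W"
        then have "card e = 2" "e \<subseteq> {v}" using card_edge W by (auto simp: inner_def)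
        then show False using card_mono[of "{v}" e] by simp
      qed
      then have "inner W = {}" by blast
      then show False using Suc.prems cU by simp
    qed
    moreover have "n = card ?U" "finite ?U" "card ?U \<le> card (inner ?U)"
      using Suc.hyps(2) Suc.prems(1,3) cU le1 by auto
    ultimately obtain k where k: "3 \<le> k" "contains_copy \<lparr>verts = ?U, edges = inner ?U\<rparr> (cycle_graph k)"
      using Suc.hyps(1) by blast
    obtain g where g: "inj_on g (verts (cycle_graph k))" "g ` verts (cycle_graph k) \<subseteq> ?U"
      "\<And>e. e \<in> edges (cycle_graph k) \<Longrightarrow> g ` e \<in> inner ?U"
      using contains_copyE[OF k(2) simple_cycle_graph[OF k(1)]] by auto
    have "contains_copy \<lparr>verts = W, edges = inner W\<rparr> (cycle_graph k)"
      using g inner_mono[of ?U W] by (intro contains_copyI[OF simple_cycle_graph[OF k(1)], of g]) auto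
    then show ?thesis using k(1) by blast
  qed
qed

end

section \<open>Translation of graphs, isolation numbers and trees\<close>

locale simple_ugraph =
  fixes G :: "'a ugraph"
  assumes simple: "simple_graph G"
begin

sublocale edge_system "edges G"
  by unfold_locales (use simple in \<open>auto simp: simple_graph_def\<close>)

lemma finite_verts: "finite (verts G)"
  using simple by (simp add: simple_graph_def)

lemma inner_verts: "inner (verts G) = edges G"
  using simple by (auto simp: inner_def simple_graph_def)

lemma adj_verts: "adj u v \<Longrightarrow> u \<in> verts G \<and> v \<in> verts G"
  using simple by (auto simp: adj_def simple_graph_def)

lemma connected_graph_iff: "connected_graph G \<longleftrightarrow> conn (verts G)"
proof
  assume con: "connected_graph G"
  then obtain r where r: "r \<in> verts G" by (auto simp: connected_graph_def)
  show "conn (verts G)"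
  proof (rule connI[OF r])
    fix S assume S: "r \<in> S" "S \<subseteq> verts G" "S \<noteq> verts G"
    then obtain y where y: "y \<in> verts G" "y \<notin> S" by auto
    have "(r, y) \<in> {(x, y). {x, y} \<in> edges G}\<^sup>*"
      using con r y by (auto simp: connected_graph_def)
    \<comment> \<open>Induction along a walk from \<open>r\<close>: its first step out of
      \<open>S\<close> is the edge sought.\<close>
    then have "y \<notin> S \<longrightarrow> (\<exists>u\<in>S. \<exists>v\<in>verts G - S. adj u v)"
    proof (induction rule: rtrancl_induct)
      case base then show ?case using S by simp
    next
      case (step a b)
      then have "adj a b" by (simp add: adj_def)
      then show ?case using step adj_verts by blast
    qed
    then show "\<exists>u\<in>S. \<exists>v\<in>verts G - S. adj u v" using y by simp
  qed
next
  assume con: "conn (verts G)"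
  show "connected_graph G"
    unfolding connected_graph_def
  proof (intro conjI ballI)
    show "verts G \<noteq> {}" using con by (auto simp: conn_def)
    fix u v assume u: "u \<in> verts G" and v: "v \<in> verts G"
    let ?R = "{(x, y). {x, y} \<in> edges G}"
    show "(u, v) \<in> ?R\<^sup>*"
    proof (rule ccontr)
      assume n: "(u, v) \<notin> ?R\<^sup>*"
      have "u \<in> {w. (u, w) \<in> ?R\<^sup>*}" "v \<notin> {w. (u, w) \<in> ?R\<^sup>*}" using n by auto
      from conn_cut[OF con u this(1) v this(2)]
      obtain a b where "a \<in> {w. (u, w) \<in> ?R\<^sup>*}" "b \<notin> {w. (u, w) \<in> ?R\<^sup>*}" "adj a b" .
      then show False by (auto simp: adj_def intro: rtrancl.rtrancl_into_rtrancl)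
    qed
  qed
qed

lemma contains_C4_iff:
  assumes "U \<subseteq> verts G"
  shows "contains_copy (induced G U) (cycle_graph 4) \<longleftrightarrow> has_C4 U"
proof
  assume "contains_copy (induced G U) (cycle_graph 4)"
  then obtain g where g: "inj_on g {..<4}" "g ` {..<4} \<subseteq> verts (induced G U)"
    "\<And>e. e \<in> edges (cycle_graph 4) \<Longrightarrow> g ` e \<in> edges (induced G U)"
    using contains_copyE[of "induced G U" "cycle_graph 4"] simple_cycle_graph[of 4] by auto
  have "cycle4 (g 0) (g 1) (g 2) (g 3)"
    unfolding cycle4_def
  proof (intro conjI)
    show "distinct [g 0, g 1, g 2, g 3]" using g(1) by (simp add: inj_on_def lessThan_4)
    show "adj (g 0) (g 1)" "adj (g 1) (g 2)" "adj (g 2) (g 3)" "adj (g 3) (g 0)"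
      using g(3)[of "{0, 1}"] g(3)[of "{1, 2}"] g(3)[of "{2, 3}"] g(3)[of "{3, 0}"]
      by (simp_all add: edges_cycle_graph_4 induced_def adj_def)
  qed
  moreover have "{g 0, g 1, g 2, g 3} \<subseteq> U" using g(2) by (simp add: lessThan_4 induced_def)
  ultimately show "has_C4 U" unfolding has_C4_def spans_C4_def by blast
next
  assume "has_C4 U"
  then obtain a b c d where Z: "{a, b, c, d} \<subseteq> U" "cycle4 a b c d"
    unfolding has_C4_def spans_C4_def by blast
  have d: "distinct [a, b, c, d]" using Z(2) by (simp add: cycle4_def)
  show "contains_copy (induced G U) (cycle_graph 4)"
  proof (rule contains_copyI[OF simple_cycle_graph, of _ "nth [a, b, c, d]"])
    show "inj_on ((!) [a, b, c, d]) (verts (cycle_graph 4))"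
      using bij_betw_nth_four[OF d] by (simp add: bij_betw_def)
    show "(!) [a, b, c, d] ` verts (cycle_graph 4) \<subseteq> verts (induced G U)"
      using bij_betw_nth_four[OF d] Z(1) assms by (auto simp: bij_betw_def induced_def)
    show "(!) [a, b, c, d] ` e \<in> edges (induced G U)" if "e \<in> edges (cycle_graph 4)" for e
      using that Z by (auto simp: edges_cycle_graph_4 induced_def cycle4_def adj_def)
  qed simp
qed

lemma isolating_set_iff: "isolating_set G (cycle_graph 4) D \<longleftrightarrow> isolates D (verts G)"
proof -
  have "verts G - closed_nbhd G D = verts G - nbhd D"
    unfolding closed_nbhd_def nbhd_def adj_def by blast
  then show ?thesis unfolding isolating_set_def isolates_def by (simp add: contains_C4_iff)
qed

lemma isolation_number_le: "isolates D (verts G) \<Longrightarrow> isolation_number G (cycle_graph 4) \<le> card D"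
  unfolding isolation_number_def isolating_set_iff by (rule Least_le) blast

lemma isolation_number_attained:
  obtains D where "isolates D (verts G)" "card D = isolation_number G (cycle_graph 4)"
proof -
  have "isolates (verts G) (verts G)"
  proof -
    have "verts G - nbhd (verts G) = {}" by (auto simp: nbhd_def)
    then have "\<not> has_C4 (verts G - nbhd (verts G))" by (metis card.empty finite.emptyI le0 not_has_C4_small)
    then show ?thesis by (simp add: isolates_def)
  qed
  then have "\<exists>n D. isolates D (verts G) \<and> card D = n" by blast
  then have "\<exists>D. isolates D (verts G) \<and> card D = isolation_number G (cycle_graph 4)"
    unfolding isolation_number_def isolating_set_iff by (rule LeastI_ex)
  then show thesis using that by blast
qed

lemma isomorphic_four:
  fixes H :: "nat ugraph"
  assumes "verts G = {a, b, c, d}" and d: "distinct [a, b, c, d]"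
    and H: "simple_graph H" "verts H = {..<4}"
    and e: "adj a b \<longleftrightarrow> {0, 1} \<in> edges H" "adj a c \<longleftrightarrow> {0, 2} \<in> edges H" "adj a d \<longleftrightarrow> {0, 3} \<in> edges H"
      "adj b c \<longleftrightarrow> {1, 2} \<in> edges H" "adj b d \<longleftrightarrow> {1, 3} \<in> edges H" "adj c d \<longleftrightarrow> {2, 3} \<in> edges H"
  shows "isomorphic G H"
proof (rule isomorphic_sym_witness)
  let ?g = "nth [a, b, c, d]"
  show "bij_betw ?g (verts H) (verts G)" using bij_betw_nth_four[OF d] assms(1) H(2) by simp
  have lt: "adj (?g i) (?g j) \<longleftrightarrow> {i, j} \<in> edges H" if "i < j" "j < 4" for i j
  proof -
    have "i = 0 \<and> j = 1 \<or> i = 0 \<and> j = 2 \<or> i = 0 \<and> j = 3 \<or> i = 1 \<and> j = 2 \<or> i = 1 \<and> j = 3 \<or> i = 2 \<and> j = 3"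
      using that by arith
    then show ?thesis using e by (elim disjE conjE) simp_all
  qed
  have self: "{i, i} \<notin> edges H" for i using H(1) by (fastforce simp: simple_graph_def)
  fix i j assume "i \<in> verts H" "j \<in> verts H"
  then have ij: "i < 4" "j < 4" using H(2) by auto
  show "{?g i, ?g j} \<in> edges G \<longleftrightarrow> {i, j} \<in> edges H"
  proof (cases i j rule: linorder_cases)
    case less
    then show ?thesis using lt[of i j] ij by (simp add: adj_def)
  next
    case equal
    then show ?thesis using self[of i] not_adj_self[of "?g i", unfolded adj_def] by simp
  next
    case greater
    then have "adj (?g j) (?g i) \<longleftrightarrow> {j, i} \<in> edges H"
      using lt ij by blast
    then show ?thesis by (simp add: adj_def insert_commute)
  qed
qed

text \<open>The starting vertex is free so that a copy can be labelled from its attachment vertex: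
  \<open>cons_graph\<close> attaches copies at \<open>0\<close>.\<close>

lemma is_C4_labelling:
  assumes "is_C4 Z" "z \<in> Z"
  obtains c where "bij_betw c {..<4 :: nat} Z" "c 0 = z"
    "\<And>i j. i < 4 \<Longrightarrow> j < 4 \<Longrightarrow> adj (c i) (c j) \<longleftrightarrow> {i, j} \<in> edges (cycle_graph 4)"
proof -
  obtain b c d where Z: "Z = {z, b, c, d}" "cycle4 z b c d" "\<not> adj z c" "\<not> adj b d"
    using is_C4_at[OF assms] .
  let ?g = "nth [z, b, c, d]"
  have d: "distinct [z, b, c, d]" using Z(2) by (simp add: cycle4_def)
  have e: "adj z b" "adj b c" "adj c d" "adj z d" using Z(2) adj_sym by (simp_all add: cycle4_def)
  have lt: "adj (?g i) (?g j) \<longleftrightarrow> {i, j} \<in> edges (cycle_graph 4)" if "i < j" "j < 4" for i j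
  proof -
    have "i = 0 \<and> j = 1 \<or> i = 0 \<and> j = 2 \<or> i = 0 \<and> j = 3 \<or> i = 1 \<and> j = 2 \<or> i = 1 \<and> j = 3 \<or> i = 2 \<and> j = 3"
      using that by arith
    then show ?thesis using e Z(3,4)
      by (elim disjE conjE) (simp_all add: edges_cycle_graph_4 doubleton_eq_iff)
  qed
  have self: "{i, i} \<notin> edges (cycle_graph 4)" for i
    using simple_cycle_graph[of 4] by (fastforce simp: simple_graph_def)
  show thesis
  proof (rule that[of ?g])
    show "bij_betw ?g {..<4} Z" using bij_betw_nth_four[OF d] Z(1) by simp
    fix i j :: nat assume ij: "i < 4" "j < 4"
    show "adj (?g i) (?g j) \<longleftrightarrow> {i, j} \<in> edges (cycle_graph 4)"
    proof (cases i j rule: linorder_cases)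
      case less
      then show ?thesis using lt[of i j] ij by simp
    next
      case equal
      then show ?thesis using self[of i] by simp
    next
      case greater
      then have "adj (?g j) (?g i) \<longleftrightarrow> {j, i} \<in> edges (cycle_graph 4)" using lt ij by blast
      then show ?thesis using adj_sym[of "?g i" "?g j"] by (simp add: insert_commute)
    qed
  qed simp
qed

lemma isomorphic_C4:
  assumes "is_C4 (verts G)"
  shows "isomorphic G (cycle_graph 4)"
proof -
  obtain z where "z \<in> verts G" using assms unfolding is_C4_def by blast
  then obtain c where c: "bij_betw c {..<4 :: nat} (verts G)"
    "\<And>i j. i < 4 \<Longrightarrow> j < 4 \<Longrightarrow> adj (c i) (c j) \<longleftrightarrow> {i, j} \<in> edges (cycle_graph 4)"
    using is_C4_labelling[OF assms] by metis
  show ?thesis by (rule isomorphic_sym_witness[of c]) (use c in \<open>simp_all add: adj_def\<close>)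
qed

lemma isomorphic_diamond:
  assumes "is_diamond (verts G)"
  shows "isomorphic G diamond"
proof -
  obtain a b c d where Z: "verts G = {a, b, c, d}" "cycle4 a b c d" "adj a c" "\<not> adj b d"
    using assms unfolding is_diamond_def by blast
  \<comment> \<open>The non-adjacent pair comes first, because \<open>diamond\<close> lacks the edge
    \<open>{0, 1}\<close>.\<close>
  have V: "verts G = {b, d, a, c}" using Z(1) by auto
  have "adj b a" "adj d c" using Z(2) adj_sym by (simp_all add: cycle4_def)
  moreover have "simple_graph diamond"
    by (simp add: simple_graph_def verts_diamond edges_diamond)
  moreover have "distinct [b, d, a, c]" using Z(2) by (auto simp: cycle4_def)
  ultimately show ?thesis using Z(2-4)
    by (intro isomorphic_four[OF V])
      (simp_all add: verts_diamond edges_diamond cycle4_def doubleton_eq_iff)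
qed

text \<open>A nonempty graph with at least as many edges as vertices contains a cycle. Conversely a
  cycle has as many edges as vertices, and reaching each further vertex of a connected graph costs
  at least one more edge.\<close>

lemma tree_iff:
  "tree G \<longleftrightarrow> conn (verts G) \<and> card (edges G) + 1 \<le> card (verts G)"
proof
  assume t: "tree G"
  then have c: "conn (verts G)" by (simp add: tree_def connected_graph_iff)
  then have "verts G \<noteq> {}" by (auto simp: conn_def)
  moreover have "\<lparr>verts = verts G, edges = inner (verts G)\<rparr> = G" by (simp add: inner_verts)
  ultimately have "\<not> card (verts G) \<le> card (edges G)"
    using t cycle_if_many_edges[OF finite_verts] by (metis inner_verts tree_def)
  then show "conn (verts G) \<and> card (edges G) + 1 \<le> card (verts G)" using c by simp
next
  assume a: "conn (verts G) \<and> card (edges G) + 1 \<le> card (verts G)"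
  have "\<not> contains_copy G (cycle_graph k)" if k: "3 \<le> k" for k
  proof
    assume "contains_copy G (cycle_graph k)"
    then obtain g where g: "inj_on g {..<k}" "g ` {..<k} \<subseteq> verts G"
      "\<And>e. e \<in> edges (cycle_graph k) \<Longrightarrow> g ` e \<in> edges G"
      using contains_copyE[of G "cycle_graph k"] simple_cycle_graph[OF k] by auto
    let ?C = "g ` {..<k}"
    have sub: "e \<subseteq> {..<k}" if "e \<in> edges (cycle_graph k)" for e
      using simple_cycle_graph[OF k] that by (auto simp: simple_graph_def)
    have "card (edges (cycle_graph k)) \<le> card (inner ?C)"
    proof (rule card_inj_on_le)
      show "inj_on (\<lambda>e. g ` e) (edges (cycle_graph k))"
        using g(1) sub by (auto simp: inj_on_def inj_on_image_eq_iff)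
      show "(\<lambda>e. g ` e) ` edges (cycle_graph k) \<subseteq> inner ?C"
        using g(3) sub by (fastforce simp: inner_def)
    qed (simp add: finite_inner)
    moreover have "card (inner ?C) + card (verts G - ?C) \<le> card (inner (verts G))"
      using card_inner_connected_ge[OF finite_verts _ g(2)] a k by (auto simp: lessThan_empty_iff)
    moreover have "card (verts G - ?C) = card (verts G) - k"
      using g(1,2) by (simp add: card_Diff_subset card_image)
    moreover have "k \<le> card (verts G)"
      using card_mono[OF finite_verts g(2)] g(1) by (simp add: card_image)
    ultimately show False using a card_edges_cycle_graph[OF k] unfolding inner_verts by linarith
  qed
  then show "tree G" using a simple by (simp add: tree_def connected_graph_iff)
qed



text \<open>The tree is \<open>T\<close> relabelled by natural numbers, over which
  \<open>cons_family\<close> quantifies. That it has no cycle follows from the count: every copy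
  uses up five edges, its own four and the one to \<open>T\<close>, which leaves at most
  \<open>card T - 1\<close> edges inside \<open>T\<close>.\<close>

lemma is_cons_imp_cons_family:
  assumes "is_cons (verts G)"
  shows "G \<in> cons_family 4"
proof -
  obtain T Q where cons: "cons_shape (verts G) T Q" and count: "card (edges G) + 1 = 6 * card T"
    using assms unfolding is_cons_def inner_verts by blast
  note cD = cons_shapeD[OF cons]
  have finT: "finite T" using cD(2) finite_verts finite_subset by blast
  have "\<forall>t\<in>T. \<exists>c. bij_betw c {..<4 :: nat} (Q t) \<and> adj t (c 0) \<and>
      (\<forall>u\<in>Q t. \<forall>v\<in>verts G - Q t. adj u v \<longrightarrow> u = c 0 \<and> v = t) \<and>
      (\<forall>i<4. \<forall>j<4. adj (c i) (c j) \<longleftrightarrow> {i, j} \<in> edges (cycle_graph 4))"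
  proof
    fix t assume t: "t \<in> T"
    obtain q where q: "q \<in> Q t" "adj t q"
      "\<And>u v. u \<in> Q t \<Longrightarrow> v \<in> verts G \<Longrightarrow> v \<notin> Q t \<Longrightarrow> adj u v \<Longrightarrow> u = q \<and> v = t"
      by (rule cons_attachment[OF cons t]) (rule that, blast+)
    obtain c where c: "bij_betw c {..<4 :: nat} (Q t)" "c 0 = q"
      "\<And>i j. i < 4 \<Longrightarrow> j < 4 \<Longrightarrow> adj (c i) (c j) \<longleftrightarrow> {i, j} \<in> edges (cycle_graph 4)"
      by (rule is_C4_labelling[OF cD(4)[OF t] q(1)]) (rule that, blast+)
    show "\<exists>c. bij_betw c {..<4 :: nat} (Q t) \<and> adj t (c 0) \<and>
      (\<forall>u\<in>Q t. \<forall>v\<in>verts G - Q t. adj u v \<longrightarrow> u = c 0 \<and> v = t) \<and>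
      (\<forall>i<4. \<forall>j<4. adj (c i) (c j) \<longleftrightarrow> {i, j} \<in> edges (cycle_graph 4))"
    proof (intro exI[of _ c] conjI ballI allI impI)
      show "adj t (c 0)" using c(2) q(2) by simp
      show "u = c 0" "v = t" if "u \<in> Q t" "v \<in> verts G - Q t" "adj u v" for u v
        using q(3)[of u v] that c(2) by blast+
    qed (use c in blast)+
  qed
  from bchoice[OF this] obtain cyc where cyc:
    "\<And>t. t \<in> T \<Longrightarrow> bij_betw (cyc t) {..<4 :: nat} (Q t)" "\<And>t. t \<in> T \<Longrightarrow> adj t (cyc t 0)"
    "\<And>t u v. t \<in> T \<Longrightarrow> u \<in> Q t \<Longrightarrow> v \<in> verts G \<Longrightarrow> v \<notin> Q t \<Longrightarrow> adj u v \<Longrightarrow> u = cyc t 0 \<and> v = t"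
    "\<And>t i j. t \<in> T \<Longrightarrow> i < 4 \<Longrightarrow> j < 4 \<Longrightarrow> adj (cyc t i) (cyc t j) \<longleftrightarrow> {i, j} \<in> edges (cycle_graph 4)"
    by blast
  let ?n = "card T"
  obtain h where h: "bij_betw h {..<?n} T"
    using ex_bij_betw_nat_finite[OF finT] by (auto simp: atLeast0LessThan)
  have hT: "h i \<in> T" if "i < ?n" for i using h that by (auto simp: bij_betw_def)
  have hinj: "h i = h j \<longleftrightarrow> i = j" if "i < ?n" "j < ?n" for i j
    using h that by (auto simp: bij_betw_def inj_on_def)
  define T0 where "T0 = \<lparr>verts = {..<?n}, edges = {{i, j} | i j. i < ?n \<and> j < ?n \<and> adj (h i) (h j)}\<rparr>"
  have e0: "{i, j} \<in> edges T0 \<longleftrightarrow> i < ?n \<and> j < ?n \<and> adj (h i) (h j)" for i j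
    using adj_sym by (auto simp: T0_def doubleton_eq_iff)
  have ne0: "e \<in> edges T0 \<Longrightarrow> \<exists>i j. e = {i, j} \<and> i < ?n \<and> j < ?n \<and> adj (h i) (h j)" for e
    by (auto simp: T0_def)
  have simple0: "simple_graph T0"
    unfolding simple_graph_def
  proof (intro conjI ballI)
    show "finite (verts T0)" by (simp add: T0_def)
    fix e assume "e \<in> edges T0"
    then obtain i j where ij: "e = {i, j}" "i < ?n" "j < ?n" "adj (h i) (h j)" using ne0 by blast
    then have "i \<noteq> j" using not_adj_self by auto
    then show "e \<subseteq> verts T0" "card e = 2" using ij by (simp_all add: T0_def)
  qed
  interpret T0: simple_ugraph T0 by unfold_locales (rule simple0)
  have T0adj: "T0.adj i j \<longleftrightarrow> i < ?n \<and> j < ?n \<and> adj (h i) (h j)" for i j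
    unfolding T0.adj_def by (rule e0)
  have tree: "tree T0"
    unfolding T0.tree_iff
  proof
    obtain r where "r \<in> T" using cD(1) by (auto simp: conn_def)
    then have pos: "0 < ?n" using finT by (auto simp: card_gt_0_iff)
    show "T0.conn (verts T0)"
    proof (rule T0.connI[of 0])
      show "0 \<in> verts T0" using pos by (simp add: T0_def)
      fix S assume S: "0 \<in> S" "S \<subseteq> verts T0" "S \<noteq> verts T0"
      then obtain y where y: "y < ?n" "y \<notin> S" by (auto simp: T0_def)
      have lt: "i < ?n" if "i \<in> S" for i using that S(2) by (auto simp: T0_def)
      have "h y \<notin> h ` S" using y hinj lt by blast
      moreover have "h 0 \<in> T" "h 0 \<in> h ` S" "h y \<in> T" using hT pos y S by auto
      ultimately obtain u v where uv: "u \<in> h ` S" "v \<in> T" "v \<notin> h ` S" "adj u v"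
        using conn_cut[OF cD(1)] by metis
      obtain i where i: "i \<in> S" "u = h i" using uv(1) by blast
      obtain j where j: "j < ?n" "v = h j" using uv(2) h by (auto simp: bij_betw_def)
      have "T0.adj i j" using uv(4) i j lt by (simp add: T0adj)
      moreover have "j \<in> verts T0 - S" using j uv(3) by (auto simp: T0_def)
      ultimately show "\<exists>u\<in>S. \<exists>v\<in>verts T0 - S. T0.adj u v" using i(1) by blast
    qed
    have "card (edges T0) \<le> card (inner T)"
    proof (rule card_inj_on_le[OF _ _ finite_inner[OF finT]])
      have "e \<subseteq> {..<?n}" if "e \<in> edges T0" for e using ne0[OF that] by auto
      then show "inj_on (\<lambda>e. h ` e) (edges T0)"
        using h by (auto simp: inj_on_def bij_betw_def inj_on_image_eq_iff)
      show "(\<lambda>e. h ` e) ` edges T0 \<subseteq> inner T"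
      proof
        fix d assume "d \<in> (\<lambda>e. h ` e) ` edges T0"
        then obtain e where e: "e \<in> edges T0" "d = h ` e" by blast
        obtain i j where "e = {i, j}" "i < ?n" "j < ?n" "adj (h i) (h j)" using ne0[OF e(1)] by blast
        then show "d \<in> inner T" using e(2) hT by (simp add: inner_def adj_def)
      qed
    qed
    moreover have "card (inner T) + 5 * card T \<le> card (edges G)"
    proof -
      have "card (inner T) + (\<Sum>t\<in>T. card (inner (Q t)) + card (between (Q t) T)) \<le> card (inner (verts G))"
        by (rule card_inner_family[OF finite_verts finT cD(2)]) (use cD(5,6,7) in blast)+
      moreover have "(\<Sum>t\<in>T. 5) \<le> (\<Sum>t\<in>T. card (inner (Q t)) + card (between (Q t) T))"
      proof (rule sum_mono)
        fix t assume t: "t \<in> T"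
        have "cyc t 0 \<in> Q t" using cyc(1)[OF t] by (auto simp: bij_betw_def)
        then have "{cyc t 0, t} \<in> between (Q t) T"
          using edge_in_between cyc(2)[OF t] t adj_sym by blast
        moreover have "finite (between (Q t) T)"
          using finite_between finT cD(6)[OF t] finite_verts finite_subset by blast
        ultimately have "1 \<le> card (between (Q t) T)" by (metis One_nat_def Suc_leI card_gt_0_iff empty_iff)
        then show "5 \<le> card (inner (Q t)) + card (between (Q t) T)"
          using card_inner_is_C4[OF cD(4)[OF t]] by simp
      qed
      ultimately show ?thesis by (simp add: inner_verts)
    qed
    ultimately show "card (edges T0) + 1 \<le> card (verts T0)" using count by (simp add: T0_def)
  qed
  define g where "g = (\<lambda>x. case x of Inl i \<Rightarrow> h i | Inr (i, j) \<Rightarrow> cyc (h i) j)"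
  have g [simp]: "g (Inl i) = h i" "g (Inr (i, j)) = cyc (h i) j" for i j by (simp_all add: g_def)
  have vc: "verts (cons_graph T0 4) = Inl ` {..<?n} \<union> Inr ` ({..<?n} \<times> {..<4})"
    by (simp add: cons_graph_def T0_def)
  have cycQ: "cyc t i \<in> Q t" if "t \<in> T" "i < 4" for t i using cyc(1) that by (auto simp: bij_betw_def)
  have cyc_inj: "cyc t i = cyc t j \<longleftrightarrow> i = j" if "t \<in> T" "i < 4" "j < 4" for t i j
    using cyc(1) that by (auto simp: bij_betw_def inj_on_def)
  have QT: "x \<notin> T" if "t \<in> T" "x \<in> Q t" for x t using cD(5) that by blast
  have QQ: "s = t" if "s \<in> T" "t \<in> T" "x \<in> Q s" "x \<in> Q t" for s t x using cD(7) that by blast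
  have QG: "x \<in> verts G" if "t \<in> T" "x \<in> Q t" for x t using cD(6) that by blast
  have "isomorphic G (cons_graph T0 4)"
  proof (rule isomorphic_sym_witness[of g])
    have "inj_on g (verts (cons_graph T0 4))"
    proof (rule inj_onI)
      fix x y assume x: "x \<in> verts (cons_graph T0 4)" and y: "y \<in> verts (cons_graph T0 4)" and eq: "g x = g y"
      consider i j where "x = Inl i" "y = Inl j" "i < ?n" "j < ?n"
        | i k l where "x = Inl i" "y = Inr (k, l)" "i < ?n" "k < ?n" "l < 4"
        | i k l where "y = Inl i" "x = Inr (k, l)" "i < ?n" "k < ?n" "l < 4"
        | i j k l where "x = Inr (i, j)" "y = Inr (k, l)" "i < ?n" "j < 4" "k < ?n" "l < 4"
        using x y unfolding vc by blast
      then show "x = y"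
      proof cases
        case 1 then show ?thesis using eq hinj by simp
      next
        case 2 then show ?thesis using eq QT[OF hT cycQ[OF hT]] hT by (metis g)
      next
        case 3 then show ?thesis using eq QT[OF hT cycQ[OF hT]] hT by (metis g)
      next
        case 4
        have "cyc (h i) j \<in> Q (h i)" "cyc (h i) j \<in> Q (h k)"
          using 4 eq cycQ[OF hT[of i], of j] cycQ[OF hT[of k], of l] by simp_all
        then have "h i = h k" using QQ hT 4 by blast
        then have "i = k" using hinj 4 by blast
        then show ?thesis using 4 eq cyc_inj hT by simp
      qed
    qed
    moreover have "g ` verts (cons_graph T0 4) = verts G"
    proof -
      have "g ` Inl ` {..<?n} = T" using h by (simp add: image_image bij_betw_def)
      moreover have "g ` Inr ` ({..<?n} \<times> {..<4}) = (\<Union>t\<in>T. Q t)"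
      proof (intro equalityI subsetI)
        fix x assume "x \<in> g ` Inr ` ({..<?n} \<times> {..<4})"
        then obtain i j where "i < ?n" "j < 4" "x = cyc (h i) j" by auto
        then show "x \<in> (\<Union>t\<in>T. Q t)" using cycQ hT by blast
      next
        fix x assume "x \<in> (\<Union>t\<in>T. Q t)"
        then obtain t where t: "t \<in> T" "x \<in> Q t" by blast
        obtain i where i: "i < ?n" "t = h i" using t(1) h by (auto simp: bij_betw_def)
        obtain j where j: "j < 4" "x = cyc t j" using t cyc(1)[OF t(1)] by (auto simp: bij_betw_def)
        have "x = g (Inr (i, j))" using i j by simp
        then show "x \<in> g ` Inr ` ({..<?n} \<times> {..<4})" using i(1) j(1) by blast
      qed
      ultimately show ?thesis using cD(3) unfolding vc image_Un by simp
    qed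
    ultimately show "bij_betw g (verts (cons_graph T0 4)) (verts G)" by (simp add: bij_betw_def)
  next
    have mixed: "adj (h u) (cyc (h v) i) \<longleftrightarrow> u = v \<and> i = 0" if "u < ?n" "v < ?n" "i < 4" for u v i
    proof
      assume "adj (h u) (cyc (h v) i)"
      then have "cyc (h v) i = cyc (h v) 0 \<and> h u = h v"
        using that hT cycQ QT adj_sym cD(2) by (intro cyc(3)) blast+
      then show "u = v \<and> i = 0" using that hinj cyc_inj hT by simp
    next
      assume "u = v \<and> i = 0"
      then show "adj (h u) (cyc (h v) i)" using cyc(2) hT that by simp
    qed
    have vT: "v \<in> verts T0 \<longleftrightarrow> v < ?n" for v by (simp add: T0_def)
    fix x y assume x: "x \<in> verts (cons_graph T0 4)" and y: "y \<in> verts (cons_graph T0 4)"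
    consider i j where "x = Inl i" "y = Inl j" "i < ?n" "j < ?n"
      | i k l where "x = Inl i" "y = Inr (k, l)" "i < ?n" "k < ?n" "l < 4"
      | i k l where "y = Inl i" "x = Inr (k, l)" "i < ?n" "k < ?n" "l < 4"
      | i j k l where "x = Inr (i, j)" "y = Inr (k, l)" "i < ?n" "j < 4" "k < ?n" "l < 4"
      using x y unfolding vc by blast
    then have "adj (g x) (g y) \<longleftrightarrow> {x, y} \<in> edges (cons_graph T0 4)"
    proof cases
      case 1 then show ?thesis by (simp add: e0)
    next
      case 2 then show ?thesis using mixed by (auto simp: vT)
    next
      case 3 then show ?thesis using mixed[of i k l] adj_sym[of "h i"] by (auto simp: vT)
    next
      case 4
      show ?thesis
      proof (cases "i = k")
        case True
        then show ?thesis using 4 cyc(4) hT by (simp add: vT)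
      next
        case False
        have "\<not> adj (cyc (h i) j) (cyc (h k) l)"
        proof
          assume a: "adj (cyc (h i) j) (cyc (h k) l)"
          have k: "cyc (h k) l \<in> Q (h k)" using cycQ hT 4 by blast
          then have "cyc (h k) l \<notin> Q (h i)" using False hinj QQ hT 4 by blast
          then have "cyc (h k) l = h i"
            using cyc(3)[OF hT cycQ[OF hT] _ _ a] 4 k QG hT by blast
          then show False using QT[OF hT k] hT 4 by simp
        qed
        then show ?thesis using 4 False by simp
      qed
    qed
    then show "{g x, g y} \<in> edges G \<longleftrightarrow> {x, y} \<in> edges (cons_graph T0 4)" by (simp add: adj_def)
  qed
  then show ?thesis using tree by (auto simp: cons_family_def)
qed

text \<open>The closed neighbourhood of the copy at \<open>t\<close> is that copy together with
  \<open>t\<close>, so those of different copies are disjoint. An isolating set meets each of them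
  and hence has at least as many elements as the tree has vertices. The graph has at most
  \<open>card (verts T) - 1\<close> edges in the tree and five more per tree vertex.\<close>

lemma cons_family_extremal:
  assumes "G \<in> cons_family 4"
  shows "card (edges G) + 1 \<le> 6 * isolation_number G (cycle_graph 4)"
proof -
  obtain T :: "nat ugraph" where T: "tree T" "isomorphic G (cons_graph T 4)"
    using assms by (auto simp: cons_family_def)
  interpret T: simple_ugraph T by unfold_locales (use T in \<open>simp add: tree_def\<close>)
  have finE: "finite (edges T)" using T.finite_inner[OF T.finite_verts] by (simp add: T.inner_verts)
  obtain f where f: "bij_betw f (verts G) (verts (cons_graph T 4))"
    "\<And>u v. u \<in> verts G \<Longrightarrow> v \<in> verts G \<Longrightarrow> {u, v} \<in> edges G \<longleftrightarrow> {f u, f v} \<in> edges (cons_graph T 4)"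
    using T(2) by (auto simp: isomorphic_def)
  \<comment> \<open>One image for each kind of edge; bounding the cardinalities of the images gives
    the upper bound.\<close>
  let ?A = "(\<lambda>e. Inl ` e) ` edges T :: (nat + nat \<times> nat) set set"
  let ?B = "(\<lambda>(v, e). (\<lambda>i. Inr (v, i)) ` e) ` (verts T \<times> edges (cycle_graph 4)) :: (nat + nat \<times> nat) set set"
  let ?C = "(\<lambda>v. {Inl v, Inr (v, 0)}) ` verts T :: (nat + nat \<times> nat) set set"
  have fin4: "finite (edges (cycle_graph 4))" by (simp add: edges_cycle_graph_4)
  have sub: "edges (cons_graph T 4) \<subseteq> ?A \<union> ?B \<union> ?C"
  proof
    fix e assume "e \<in> edges (cons_graph T 4)"
    then consider u v where "e = {Inl u, Inl v}" "{u, v} \<in> edges T"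
      | v i j where "e = {Inr (v, i), Inr (v, j)}" "v \<in> verts T" "{i, j} \<in> edges (cycle_graph 4)"
      | v where "e = {Inl v, Inr (v, 0)}" "v \<in> verts T"
      unfolding cons_graph_def by auto
    then show "e \<in> ?A \<union> ?B \<union> ?C"
    proof cases
      case 1
      then have "e = Inl ` {u, v}" by simp
      then show ?thesis using 1 by blast
    next
      case 2
      then have "e = (\<lambda>(v, e). (\<lambda>i. Inr (v, i)) ` e) (v, {i, j})" by simp
      then show ?thesis using 2 by blast
    next
      case 3 then show ?thesis by blast
    qed
  qed
  have finABC: "finite (?A \<union> ?B \<union> ?C)" using finE fin4 T.finite_verts by simp
  have "card (edges (cons_graph T 4)) \<le> card (?A \<union> ?B \<union> ?C)" by (rule card_mono[OF finABC sub])
  also have "\<dots> \<le> card ?A + card ?B + card ?C"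
    using card_Un_le[of "?A \<union> ?B" ?C] card_Un_le[of ?A ?B] by linarith
  also have "\<dots> \<le> card (edges T) + card (verts T) * 4 + card (verts T)"
    using card_image_le[OF finE, of "\<lambda>e. Inl ` e"] card_image_le[OF T.finite_verts]
      card_image_le[of "verts T \<times> edges (cycle_graph 4)" "\<lambda>(v, e). (\<lambda>i. Inr (v, i)) ` e"]
      fin4 T.finite_verts card_edges_cycle_graph[of 4]
    by (intro add_mono) (simp_all add: card_cartesian_product)
  finally have "card (edges (cons_graph T 4)) + 1 \<le> 6 * card (verts T)"
    using T(1) T.tree_iff by simp
  moreover have "card (edges G) \<le> card (edges (cons_graph T 4))"
    using card_edges_isomorphic_le[OF simple T(2) finite_subset[OF sub finABC]] .
  moreover have "card (verts T) \<le> isolation_number G (cycle_graph 4)"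
  proof -
    obtain D where D: "isolates D (verts G)" "card D = isolation_number G (cycle_graph 4)"
      using isolation_number_attained .
    have DG: "D \<subseteq> verts G" using D(1) by (simp add: isolates_def)
    \<comment> \<open>\<open>?p\<close> sends a vertex to the tree vertex it belongs to, and is
      constant on the closed neighbourhood of a copy.\<close>
    let ?p = "\<lambda>x. case x of Inl v \<Rightarrow> v | Inr w \<Rightarrow> fst w"
    have "verts T \<subseteq> (\<lambda>u. ?p (f u)) ` D"
    proof
      fix t assume t: "t \<in> verts T"
      define c where "c = (\<lambda>i. inv_into (verts G) f (Inr (t, i)))"
      have vt: "Inr (t, i) \<in> verts (cons_graph T 4)" if "i < 4" for i
        using t that by (simp add: cons_graph_def)
      have c: "c i \<in> verts G" "f (c i) = Inr (t, i)" if "i < 4" for i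
        using vt[OF that] f(1) unfolding c_def bij_betw_def by (simp_all add: inv_into_into f_inv_into_f)
      have "cycle4 (c 0) (c 1) (c 2) (c 3)"
        unfolding cycle4_def
      proof (intro conjI)
        have "c i \<noteq> c j" if "i < 4" "j < 4" "i \<noteq> j" for i j
          using c[OF that(1)] c[OF that(2)] that(3) by auto
        then show "distinct [c 0, c 1, c 2, c 3]" by simp
        show "adj (c 0) (c 1)" "adj (c 1) (c 2)" "adj (c 2) (c 3)" "adj (c 3) (c 0)"
          unfolding adj_def using c t by (simp_all add: f(2) edges_cycle_graph_4)
      qed
      then have "spans_C4 {c 0, c 1, c 2, c 3}" unfolding spans_C4_def by blast
      then have "\<not> {c 0, c 1, c 2, c 3} \<subseteq> verts G - nbhd D"
        using D(1) unfolding isolates_def has_C4_def by blast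
      then have "\<exists>i\<in>{..<4}. c i \<in> nbhd D"
        using c(1)[of 0] c(1)[of 1] c(1)[of 2] c(1)[of 3] by (auto simp: lessThan_4)
      then obtain i where i: "i < 4" "c i \<in> nbhd D" by blast
      show "t \<in> (\<lambda>u. ?p (f u)) ` D"
      proof (cases "c i \<in> D")
        case True
        then show ?thesis using c(2)[OF i(1)] by (force simp: image_iff)
      next
        case False
        then obtain u where u: "u \<in> D" "adj u (c i)" using i(2) by (auto simp: nbhd_def)
        then have e: "{f u, Inr (t, i)} \<in> edges (cons_graph T 4)"
          using f(2)[of u "c i"] DG c[OF i(1)] by (auto simp: adj_def)
        have "?p (f u) = t"
        proof (cases "f u")
          case (Inl v) then show ?thesis using e by simp
        next
          case (Inr w) then show ?thesis using e by (cases w) simp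
        qed
        then show ?thesis using u(1) by force
      qed
    qed
    then have "card (verts T) \<le> card ((\<lambda>u. ?p (f u)) ` D)"
      using DG finite_verts finite_subset by (intro card_mono) blast+
    also have "\<dots> \<le> card D" using DG finite_verts finite_subset by (intro card_image_le) blast
    finally show ?thesis using D(2) by simp
  qed
  ultimately show ?thesis by linarith
qed

text \<open>There are only five edges, and the four-cycle in the diamond rules out the empty
  isolating set.\<close>

lemma diamond_extremal:
  assumes "isomorphic G diamond"
  shows "card (edges G) + 1 \<le> 6 * isolation_number G (cycle_graph 4)"
proof -
  obtain f where f: "bij_betw f (verts G) (verts diamond)"
    "\<And>u v. u \<in> verts G \<Longrightarrow> v \<in> verts G \<Longrightarrow> {u, v} \<in> edges G \<longleftrightarrow> {f u, f v} \<in> edges diamond"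
    using assms by (auto simp: isomorphic_def)
  define c where "c = inv_into (verts G) f"
  have c: "c i \<in> verts G" "f (c i) = i" if "i < 4" for i
    using that f(1) unfolding c_def bij_betw_def verts_diamond by (simp_all add: inv_into_into f_inv_into_f)
  have "cycle4 (c 0) (c 2) (c 1) (c 3)"
    unfolding cycle4_def
  proof (intro conjI)
    have "c i \<noteq> c j" if "i < 4" "j < 4" "i \<noteq> j" for i j
      using c[OF that(1)] c[OF that(2)] that(3) by auto
    then show "distinct [c 0, c 2, c 1, c 3]" by simp
    show "adj (c 0) (c 2)" "adj (c 2) (c 1)" "adj (c 1) (c 3)" "adj (c 3) (c 0)"
      unfolding adj_def using c by (simp_all add: f(2) edges_diamond)
  qed
  then have sp: "spans_C4 {c 0, c 2, c 1, c 3}" unfolding spans_C4_def by blast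
  obtain D where D: "isolates D (verts G)" "card D = isolation_number G (cycle_graph 4)"
    using isolation_number_attained .
  have "D \<noteq> {}"
  proof
    assume "D = {}"
    then have "\<not> has_C4 (verts G)" using D(1) by (simp add: isolates_def nbhd_def)
    then show False using sp c unfolding has_C4_def by auto
  qed
  moreover have "finite D" using D(1) finite_verts finite_subset unfolding isolates_def by blast
  ultimately have "1 \<le> card D" by (simp add: Suc_leI card_gt_0_iff)
  moreover have "card (edges diamond) \<le> 5" "finite (edges diamond)"
    by (simp_all add: edges_diamond card_insert_if)
  then have "card (edges G) \<le> 5" using card_edges_isomorphic_le[OF simple assms] by linarith
  ultimately show ?thesis using D(2) by linarith
qed

lemma isolation_number_le_isolable:
  assumes "isolable k (verts G)"
  shows "6 * isolation_number G (cycle_graph 4) \<le> card (edges G) + k"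
  using assms isolation_number_le unfolding isolable_def inner_verts
  by (meson le_trans mult_le_mono2)

end

theorem theorem1p4:
  fixes G :: "'a ugraph" and m :: nat
  assumes "simple_graph G"
    and "connected_graph G"
    and "m = card (edges G)"
    and "\<not> isomorphic G (cycle_graph 4)"
  shows "real (isolation_number G (cycle_graph 4)) \<le> (real m + 1) / 6 \<and>
    (real (isolation_number G (cycle_graph 4)) = (real m + 1) / 6 \<longleftrightarrow>
      isomorphic G diamond \<or> G \<in> cons_family 4)"
proof -
  interpret simple_ugraph G by unfold_locales (rule assms(1))
  let ?i = "isolation_number G (cycle_graph 4)"
  have "classified (verts G)"
    using connected_classified[OF finite_verts] assms(2) connected_graph_iff by blast
  then have cls: "isolable 0 (verts G) \<or> tight (verts G)"
    using isomorphic_C4 assms(4) unfolding classified_def by blast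
  then have "6 * ?i \<le> m + 1"
    using isolation_number_le_isolable[of 0] isolation_number_le_isolable[of 1] tight_isolable assms(3)
    by fastforce
  moreover have "6 * ?i = m + 1 \<longleftrightarrow> isomorphic G diamond \<or> G \<in> cons_family 4"
  proof
    assume "6 * ?i = m + 1"
    \<comment> \<open>\<open>isolable 0\<close> would give \<open>6 * ?i \<le> m\<close>, so that
      only \<open>tight\<close> is left.\<close>
    then have "\<not> isolable 0 (verts G)" using isolation_number_le_isolable[of 0] assms(3) by fastforce
    then show "isomorphic G diamond \<or> G \<in> cons_family 4"
      using cls isomorphic_diamond is_cons_imp_cons_family unfolding tight_def by blast
  next
    assume "isomorphic G diamond \<or> G \<in> cons_family 4"
    then have "m + 1 \<le> 6 * ?i" using diamond_extremal cons_family_extremal assms(3) by blast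
    then show "6 * ?i = m + 1" using \<open>6 * ?i \<le> m + 1\<close> by simp
  qed
  moreover have "real ?i \<le> (real m + 1) / 6 \<longleftrightarrow> 6 * ?i \<le> m + 1"
    by (subst of_nat_le_iff[symmetric, where ?'a = real]) (simp add: field_simps)
  moreover have "real ?i = (real m + 1) / 6 \<longleftrightarrow> 6 * ?i = m + 1"
    by (subst of_nat_eq_iff[symmetric, where ?'a = real]) (simp add: field_simps)
  ultimately show ?thesis by blast
qed

end
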